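(* Let $S$ be a self-adjoint subspace in $X^2$ and $A$ a closed Hermitian subspace in $X^2$ with $D(S)\subset D(A)$. If $A_s$ is $S_s$-compact, then $\sigma_e(S)=\sigma_e(S+A)$; consequently $\sigma_e(S)=\emptyset$ if and only if $\sigma_e(S+A)=\emptyset$.
   Context: $X$ is a complex Hilbert space and $X^2=X\times X$ carries the inner product $\langle (x,f),(y,g)\rangle=\langle x,y\rangle+\langle f,g\rangle$. A subspace $T$ in $X^2$ means a linear subspace of $X^2$ (a linear relation); a linear operator in $X$ is identified with its graph. Notation: $D(T)=\{x:(x,f)\in T \text{ for some } f\}$, $T(x)=\{f:(x,f)\in T\}$, $T^{-1}=\{(f,x):(x,f)\in T\}$, $\lambda I$ is the graph of $x\mapsto\lambda x$. The adjoint is $T^*=\{(y,g)\in X^2:\langle g,x\rangle=\langle y,f\rangle \text{ for all }(x,f)\in T\}$; $T$ is Hermitian if $T\subset T^*$ and self-adjoint if $T=T^*$. For subspaces $S,A$ in $X^2$, $S+A=\{(x,f+g):(x,f)\in S,(x,g)\in A\}$. For a closed subspace $T$, set $T_\infty=\{(0,g)\in X^2:(0,g)\in T\}$ and $T_s=T\ominus T_\infty$ (orthogonal complement of $T_\infty$ in $T$), so $T=T_s\oplus T_\infty$; $T_s$ is the graph of a linear operator (the operator part of $T$) with $D(T_s)=D(T)$ and $R(T_s)\subset T(0)^\perp$. For linear operators $U,V$ in $X$ with $D(V)\subset D(U)$: $U$ is $V$-compact if $U|_{D(V)}$ is compact as a map from $(D(V),\|\cdot\|_V)$ into $X$, where $\|x\|_V=\|x\|+\|Vx\|$.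 Resolvent set: $\rho(T)=\{\lambda\in\mathbb C:(\lambda I-T)^{-1}$ is a bounded linear operator defined on all of $X\}$; spectrum $\sigma(T)=\mathbb C\setminus\rho(T)$. A number $\lambda$ is an eigenvalue of $T$ if $(x,\lambda x)\in T$ for some $x\ne 0$, with multiplicity the dimension of $\{x:(x,\lambda x)\in T\}$. The essential spectrum $\sigma_e(T)$ is the set of points of $\sigma(T)$ that are either accumulation points of $\sigma(T)$ or isolated eigenvalues of infinite multiplicity. *)

theory Defs
  imports "HOL-Analysis.Analysis"
begin

text \<open>HOL-Analysis only provides real inner product spaces, so we introduce complex
Hilbert spaces as a type class: a real Banach space with a complex scalar multiplication
extending the real one and a complex inner product inducing the norm.\<close>

class chilbert = banach +
  fixes scaleC :: "complex \<Rightarrow> 'a \<Rightarrow> 'a"  (infixr "*\<^sub>C" 75)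
    and cinner :: "'a \<Rightarrow> 'a \<Rightarrow> complex"
  assumes scaleC_add_right: "a *\<^sub>C (x + y) = a *\<^sub>C x + a *\<^sub>C y"
    and scaleC_add_left: "(a + b) *\<^sub>C x = a *\<^sub>C x + b *\<^sub>C x"
    and scaleC_scaleC: "a *\<^sub>C (b *\<^sub>C x) = (a * b) *\<^sub>C x"
    and scaleC_one: "1 *\<^sub>C x = x"
    and scaleR_scaleC: "scaleR r x = complex_of_real r *\<^sub>C x"
    and cinner_add_left: "cinner (x + y) z = cinner x z + cinner y z"
    and cinner_scaleC_left: "cinner (a *\<^sub>C x) y = a * cinner x y"
    and cinner_commute: "cinner y x = cnj (cinner x y)"
    and norm_cinner: "complex_of_real ((norm x)\<^sup>2) = cinner x x"

type_synonym 'a rel2 = "('a \<times> 'a) set"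

definition lin_rel :: "'a::chilbert rel2 \<Rightarrow> bool" where
  "lin_rel T \<longleftrightarrow> (0, 0) \<in> T
     \<and> (\<forall>x f y g. (x, f) \<in> T \<longrightarrow> (y, g) \<in> T \<longrightarrow> (x + y, f + g) \<in> T)
     \<and> (\<forall>c x f. (x, f) \<in> T \<longrightarrow> (c *\<^sub>C x, c *\<^sub>C f) \<in> T)"

definition rdom :: "'a rel2 \<Rightarrow> 'a set" where
  "rdom T = {x. \<exists>f. (x, f) \<in> T}"

definition radjoint :: "'a::chilbert rel2 \<Rightarrow> 'a rel2" where
  "radjoint T = {(y, g). \<forall>x f. (x, f) \<in> T \<longrightarrow> cinner g x = cinner y f}"

definition hermitian :: "'a::chilbert rel2 \<Rightarrow> bool" where
  "hermitian T \<longleftrightarrow> T \<subseteq> radjoint T"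

definition selfadjoint :: "'a::chilbert rel2 \<Rightarrow> bool" where
  "selfadjoint T \<longleftrightarrow> T = radjoint T"

definition relation_sum :: "'a::chilbert rel2 \<Rightarrow> 'a rel2 \<Rightarrow> 'a rel2" where
  "relation_sum S A = {(x, f + g) | x f g. (x, f) \<in> S \<and> (x, g) \<in> A}"

definition pinner :: "'a::chilbert \<times> 'a \<Rightarrow> 'a \<times> 'a \<Rightarrow> complex" where
  "pinner p q = cinner (fst p) (fst q) + cinner (snd p) (snd q)"

definition rel_inf :: "'a::chilbert rel2 \<Rightarrow> 'a rel2" where
  "rel_inf T = {(0, g) | g. (0, g) \<in> T}"

definition op_part :: "'a::chilbert rel2 \<Rightarrow> 'a rel2" where
  "op_part T = {p \<in> T. \<forall>q \<in> rel_inf T. pinner p q = 0}"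

text \<open>U is V-compact (U, V graphs of operators, D(V) subset D(U)): U restricted to D(V)
maps sets bounded w.r.t. the graph norm of V to relatively compact sets.\<close>
definition rel_compact :: "'a::chilbert rel2 \<Rightarrow> 'a rel2 \<Rightarrow> bool" where
  "rel_compact U V \<longleftrightarrow> (\<forall>B M. B \<subseteq> V \<longrightarrow> (\<forall>(x, f) \<in> B. norm x + norm f \<le> M) \<longrightarrow>
       compact (closure {g. \<exists>x f. (x, f) \<in> B \<and> (x, g) \<in> U}))"

definition resolvent_rel :: "complex \<Rightarrow> 'a::chilbert rel2 \<Rightarrow> 'a rel2" where
  "resolvent_rel l T = {(l *\<^sub>C x - f, x) | x f. (x, f) \<in> T}"

definition bounded_everywhere_op :: "'a::chilbert rel2 \<Rightarrow> bool" where
  "bounded_everywhere_op R \<longleftrightarrow> lin_rel R \<and> (\<forall>y. \<exists>!x. (y, x) \<in> R)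
      \<and> (\<exists>C. \<forall>y x. (y, x) \<in> R \<longrightarrow> norm x \<le> C * norm y)"

definition rel_resolvent_set :: "'a::chilbert rel2 \<Rightarrow> complex set" where
  "rel_resolvent_set T = {l. bounded_everywhere_op (resolvent_rel l T)}"

definition rel_spectrum :: "'a::chilbert rel2 \<Rightarrow> complex set" where
  "rel_spectrum T = UNIV - rel_resolvent_set T"

definition eigenspace :: "'a::chilbert rel2 \<Rightarrow> complex \<Rightarrow> 'a set" where
  "eigenspace T l = {x. (x, l *\<^sub>C x) \<in> T}"

definition cindependent :: "'a::chilbert set \<Rightarrow> bool" where
  "cindependent F \<longleftrightarrow> (\<forall>c. (\<Sum>x\<in>F. c x *\<^sub>C x) = 0 \<longrightarrow> (\<forall>x\<in>F. c x = 0))"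

definition infinite_dim :: "'a::chilbert set \<Rightarrow> bool" where
  "infinite_dim E \<longleftrightarrow> (\<forall>n. \<exists>F. F \<subseteq> E \<and> finite F \<and> card F = n \<and> cindependent F)"

definition is_eigenvalue :: "'a::chilbert rel2 \<Rightarrow> complex \<Rightarrow> bool" where
  "is_eigenvalue T l \<longleftrightarrow> (\<exists>x. x \<noteq> 0 \<and> (x, l *\<^sub>C x) \<in> T)"

definition ess_spectrum :: "'a::chilbert rel2 \<Rightarrow> complex set" where
  "ess_spectrum T = {l \<in> rel_spectrum T. l islimpt rel_spectrum T
      \<or> (\<not> l islimpt rel_spectrum T \<and> is_eigenvalue T l \<and> infinite_dim (eigenspace T l))}"

end

theory Submission
  imports Defs
begin

text \<open>
A point \<open>l\<close> is semi-Fredholm for \<open>T\<close> if \<open>l - T\<close> has finite-dimensional kernel and closed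
range; equivalently, every bounded sequence along which \<open>l - T\<close> converges has a convergent
subsequence. For self-adjoint \<open>T\<close> the essential spectrum is the set of points that are not
semi-Fredholm. Indeed, if \<open>l\<close> is semi-Fredholm, splitting off the kernel of \<open>l - T\<close> shows that
\<open>m - T\<close> is bounded below for all \<open>m \<noteq> l\<close> close to \<open>l\<close>. Conversely, if the rest of the spectrum
has distance at least \<open>e\<close> from \<open>l\<close>, then \<open>s - T\<close> is bounded below by \<open>\<bar>s - l\<bar>\<close> for
\<open>s = l \<plusminus> e/2\<close>, which amounts to \<open>e \<bar>\<langle>(l - T)x, x\<rangle>\<bar> \<le> \<parallel>(l - T)x\<parallel>\<^sup>2\<close>. Polarising this form and
using that the range of \<open>l - T\<close> is dense in the complement of the kernel gives
\<open>e \<parallel>x\<parallel> \<le> \<parallel>(l - T)x\<parallel>\<close> for \<open>x\<close> in that complement.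

Since \<open>A(0) \<subseteq> S(0)\<close>, the sum \<open>S + A\<close> only depends on the operator part of \<open>A\<close>. Relative
compactness makes the relative bound arbitrarily small, so that \<open>S + A\<close> is self-adjoint
(Kato-Rellich), and along bounded sequences on which \<open>l - S\<close> or \<open>l - S - A\<close> converges the
perturbation converges on a subsequence, so that \<open>S\<close> and \<open>S + A\<close> have the same semi-Fredholm
points.
\<close>

section \<open>Complex Hilbert spaces\<close>

interpretation cvs: vector_space "scaleC :: complex \<Rightarrow> 'a::chilbert \<Rightarrow> 'a"
  by unfold_locales (simp_all add: scaleC_add_right scaleC_add_left scaleC_scaleC scaleC_one)

lemma cinner_add_right: "cinner x (y + z) = cinner x y + cinner x z"
  by (metis cinner_add_left cinner_commute complex_cnj_add)

lemma cinner_scaleC_right: "cinner x (a *\<^sub>C y) = cnj a * cinner x y"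
  by (metis cinner_scaleC_left cinner_commute complex_cnj_mult)

lemma norm_sq_eq_cinner: "(norm x)\<^sup>2 = Re (cinner x x)"
  using norm_cinner[of x] by (metis Re_complex_of_real)

lemma Re_cinner_commute: "Re (cinner x y) = Re (cinner y x)"
  by (metis cinner_commute cnj.sel(1))

lemma norm_add_sq:
  fixes x y :: "'a::chilbert"
  shows "(norm (x + y))\<^sup>2 = (norm x)\<^sup>2 + 2 * Re (cinner x y) + (norm y)\<^sup>2"
  using Re_cinner_commute[of x y]
  by (simp add: norm_sq_eq_cinner cinner_add_left cinner_add_right)

lemma norm_scaleC:
  fixes x :: "'a::chilbert"
  shows "norm (a *\<^sub>C x) = cmod a * norm x"
proof -
  have "complex_of_real ((norm (a *\<^sub>C x))\<^sup>2) = (a * cnj a) * cinner x x"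
    by (simp only: norm_cinner cinner_scaleC_left cinner_scaleC_right mult_ac)
  also have "\<dots> = complex_of_real ((cmod a * norm x)\<^sup>2)"
    by (simp add: complex_norm_square[symmetric] norm_cinner[symmetric] power_mult_distrib)
  finally have "(norm (a *\<^sub>C x))\<^sup>2 = (cmod a * norm x)\<^sup>2"
    using of_real_eq_iff by blast
  then show ?thesis
    by (simp add: power2_eq_iff_nonneg)
qed

lemma norm_diff_projection_sq:
  fixes x y :: "'a::chilbert"
  assumes "y \<noteq> 0"
  shows "(norm (x - (cinner x y / (norm y)\<^sup>2) *\<^sub>C y))\<^sup>2
    = (norm x)\<^sup>2 - (cmod (cinner x y) / norm y)\<^sup>2"
proof -
  define c where "c = cinner x y / (norm y)\<^sup>2"
  have "c * cnj (cinner x y) = complex_of_real ((cmod (cinner x y) / norm y)\<^sup>2)"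
    unfolding c_def power_divide of_real_divide complex_norm_square by simp
  then have cross: "Re (c * cnj (cinner x y)) = (cmod (cinner x y) / norm y)\<^sup>2"
    by (metis Re_complex_of_real)
  have "cmod c * norm y = cmod (cinner x y) / norm y"
    using assms by (simp add: c_def norm_divide norm_mult power2_eq_square)
  moreover have "Re (cinner x ((- c) *\<^sub>C y)) = - Re (c * cnj (cinner x y))"
    by (simp only: cinner_scaleC_right) simp
  ultimately have "(norm (x + (- c) *\<^sub>C y))\<^sup>2 = (norm x)\<^sup>2 - (cmod (cinner x y) / norm y)\<^sup>2"
    unfolding norm_add_sq norm_scaleC by (simp only: cross norm_minus_cancel)
  then show ?thesis by (simp add: c_def)
qed

lemma Cauchy_Schwarz_cinner:
  fixes x y :: "'a::chilbert"
  shows "cmod (cinner x y) \<le> norm x * norm y"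
proof (cases "y = 0")
  case True
  then show ?thesis using cinner_scaleC_right[of x 0 0] by simp
next
  case False
  have "(cmod (cinner x y) / norm y)\<^sup>2 \<le> (norm x)\<^sup>2"
    using norm_diff_projection_sq[OF False, of x]
    by (metis diff_ge_0_iff_ge zero_le_power2)
  then have "cmod (cinner x y) / norm y \<le> norm x" by (rule power2_le_imp_le) simp
  then show ?thesis using False by (simp add: divide_le_eq)
qed

interpretation cinner: bounded_bilinear "cinner :: 'a::chilbert \<Rightarrow> 'a \<Rightarrow> complex"
proof
  fix r :: real and x y :: 'a
  show "cinner (r *\<^sub>R x) y = r *\<^sub>R cinner x y" "cinner x (r *\<^sub>R y) = r *\<^sub>R cinner x y"
    by (simp_all add: scaleR_scaleC cinner_scaleC_left cinner_scaleC_right scaleR_conv_of_real)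
  show "\<exists>K. \<forall>x y::'a. cmod (cinner x y) \<le> norm x * norm y * K"
    by (rule exI[of _ 1]) (simp add: Cauchy_Schwarz_cinner)
qed (simp_all add: cinner_add_left cinner_add_right)

interpretation scaleC: bounded_bilinear "scaleC :: complex \<Rightarrow> 'a::chilbert \<Rightarrow> 'a"
proof
  fix r :: real and a :: complex and x :: 'a
  show "(r *\<^sub>R a) *\<^sub>C x = r *\<^sub>R (a *\<^sub>C x)" "a *\<^sub>C (r *\<^sub>R x) = r *\<^sub>R (a *\<^sub>C x)"
    by (simp_all add: scaleR_scaleC scaleR_conv_of_real mult.commute)
  show "\<exists>K. \<forall>a (x::'a). norm (a *\<^sub>C x) \<le> norm a * norm x * K"
    by (rule exI[of _ 1]) (simp add: norm_scaleC)
qed (simp_all add: scaleC_add_left scaleC_add_right)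

lemmas cinner_simps = cinner.add_left cinner.add_right cinner.diff_left cinner.diff_right
  cinner.minus_left cinner.minus_right cinner.scaleR_left cinner.scaleR_right
  cinner_scaleC_left cinner_scaleC_right

declare cinner.zero_left [simp] cinner.zero_right [simp]

lemma cinner_eq_zero_iff [simp]: "cinner x x = 0 \<longleftrightarrow> x = 0"
  by (metis norm_cinner of_real_eq_0_iff power_eq_0_iff norm_eq_zero cinner.zero_left)

lemma norm_diff_sq:
  fixes x y :: "'a::chilbert"
  shows "(norm (x - y))\<^sup>2 = (norm x)\<^sup>2 - 2 * Re (cinner x y) + (norm y)\<^sup>2"
  using norm_add_sq[of x "- y"] by (simp add: cinner.minus_right)

lemma norm_le_norm_add_orthogonal:
  fixes x y :: "'a::chilbert"
  assumes "cinner x y = 0"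
  shows "norm x \<le> norm (x + y)" "norm y \<le> norm (x + y)"
  using assms by (auto simp: norm_add_sq intro: power2_le_imp_le)

lemma scaleR_mem_subspace: "cvs.subspace M \<Longrightarrow> x \<in> M \<Longrightarrow> r *\<^sub>R x \<in> M"
  by (simp add: scaleR_scaleC cvs.subspace_scale)

lemma convex_subspace: "cvs.subspace M \<Longrightarrow> convex M"
  by (intro convexI cvs.subspace_add scaleR_mem_subspace)

lemma subspace_closure:
  fixes M :: "'a::chilbert set"
  assumes "cvs.subspace M"
  shows "cvs.subspace (closure M)"
  unfolding cvs.subspace_def
proof (intro conjI ballI allI)
  show "0 \<in> closure M" using cvs.subspace_0[OF assms] closure_subset by blast
next
  fix x y assume "x \<in> closure M" "y \<in> closure M"
  then obtain u v where "\<And>n. u n \<in> M" "u \<longlonglongrightarrow> x" "\<And>n. v n \<in> M" "v \<longlonglongrightarrow> y"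
    unfolding closure_sequential by blast
  then show "x + y \<in> closure M"
    unfolding closure_sequential
    by (intro exI[of _ "\<lambda>n. u n + v n"]) (simp add: cvs.subspace_add[OF assms] tendsto_add)
next
  fix c x assume "x \<in> closure M"
  then obtain u where "\<And>n. u n \<in> M" "u \<longlonglongrightarrow> x"
    unfolding closure_sequential by blast
  then show "c *\<^sub>C x \<in> closure M"
    unfolding closure_sequential
    by (intro exI[of _ "\<lambda>n. c *\<^sub>C u n"]) (simp add: cvs.subspace_scale[OF assms] scaleC.tendsto)
qed

definition orthogonal_complement :: "'a::chilbert set \<Rightarrow> 'a set" where
  "orthogonal_complement M = {x. \<forall>u\<in>M. cinner x u = 0}"

lemma orthogonal_complementD: "x \<in> orthogonal_complement M \<Longrightarrow> u \<in> M \<Longrightarrow> cinner x u = 0"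
  by (simp add: orthogonal_complement_def)

lemma closed_orthogonal_complement: "closed (orthogonal_complement M)"
  unfolding orthogonal_complement_def Collect_ball_eq
  by (intro closed_INT ballI closed_Collect_eq continuous_intros cinner.continuous_on)

lemma dist_sq_le_infdist:
  fixes C :: "'a::chilbert set"
  assumes "convex C" "p \<in> C" "q \<in> C"
  shows "(dist p q)\<^sup>2 \<le> 2 * (dist x p)\<^sup>2 + 2 * (dist x q)\<^sup>2 - 4 * (infdist x C)\<^sup>2"
proof -
  let ?m = "(1/2) *\<^sub>R p + (1/2) *\<^sub>R q"
  have "?m \<in> C" using assms by (intro convexD) auto
  then have "infdist x C \<le> norm (x - ?m)" using infdist_le by (metis dist_norm)
  then have "(infdist x C)\<^sup>2 \<le> (norm (x - ?m))\<^sup>2" by (intro power_mono infdist_nonneg)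
  moreover have "(x - p) + (x - q) = 2 *\<^sub>R (x - ?m)"
    by (simp add: scaleR_right_diff_distrib scaleR_right_distrib scaleR_2)
  then have "(norm ((x - p) + (x - q)))\<^sup>2 = 4 * (norm (x - ?m))\<^sup>2"
    by (simp add: power_mult_distrib)
  moreover have "(norm ((x - p) + (x - q)))\<^sup>2 + (norm ((x - p) - (x - q)))\<^sup>2
      = 2 * (norm (x - p))\<^sup>2 + 2 * (norm (x - q))\<^sup>2"
    unfolding norm_add_sq norm_diff_sq by simp
  moreover have "(x - p) - (x - q) = q - p" by simp
  ultimately show ?thesis by (simp add: dist_norm norm_minus_commute)
qed

definition near_minimizers :: "'a::metric_space \<Rightarrow> 'a set \<Rightarrow> real \<Rightarrow> 'a set" where
  "near_minimizers x C d = {p \<in> C. (dist x p)\<^sup>2 \<le> (infdist x C)\<^sup>2 + d}"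

lemma near_minimizers_nonempty:
  assumes "C \<noteq> {}" "d > 0"
  shows "near_minimizers x C d \<noteq> {}"
proof -
  let ?r = "sqrt ((infdist x C)\<^sup>2 + d)"
  have "infdist x C < ?r" using assms(2) by (intro real_less_rsqrt) simp
  then obtain q where q: "q \<in> C" "dist x q < ?r"
    using assms(1) by (auto simp: infdist_notempty cINF_less_iff)
  then have "(dist x q)\<^sup>2 \<le> ?r\<^sup>2" by (intro power_mono) auto
  then have "q \<in> near_minimizers x C d" using q(1) assms(2) by (simp add: near_minimizers_def)
  then show ?thesis by blast
qed

lemma near_minimizers_dist_sq_le:
  fixes C :: "'a::chilbert set"
  assumes "convex C" "p \<in> near_minimizers x C d" "q \<in> near_minimizers x C d"
  shows "(dist p q)\<^sup>2 \<le> 4 * d"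
  using dist_sq_le_infdist[OF assms(1), of p q x] assms(2,3) by (simp add: near_minimizers_def)

lemma infdist_attains_inf_convex:
  fixes C :: "'a::chilbert set"
  assumes C: "closed C" "convex C" "C \<noteq> {}"
  obtains p where "p \<in> C" "dist x p = infdist x C"
proof -
  define N where "N n = near_minimizers x C (inverse (real (Suc n)))" for n
  obtain p where p: "\<And>n. p \<in> N n"
  proof (rule decreasing_closed_nest[of N])
    show "closed (N n)" for n
      unfolding N_def near_minimizers_def Collect_conj_eq using C(1)
      by (intro closed_Int closed_Collect_le continuous_intros) simp
    show "N n \<noteq> {}" for n
      unfolding N_def by (intro near_minimizers_nonempty C) simp
    show "N n \<subseteq> N m" if "m \<le> n" for m n
    proof -
      have "(infdist x C)\<^sup>2 + inverse (real (Suc n)) \<le> (infdist x C)\<^sup>2 + inverse (real (Suc m))"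
        using that by simp
      then show ?thesis unfolding N_def near_minimizers_def by (blast intro: order_trans)
    qed
    show "\<exists>n. \<forall>p\<in>N n. \<forall>q\<in>N n. dist p q < e" if "e > 0" for e
    proof -
      obtain n where n: "inverse (real (Suc n)) < e\<^sup>2 / 4"
        using reals_Archimedean[of "e\<^sup>2 / 4"] \<open>e > 0\<close> by auto
      have "dist p q < e" if "p \<in> N n" "q \<in> N n" for p q
      proof (rule power2_less_imp_less)
        show "(dist p q)\<^sup>2 < e\<^sup>2"
          using near_minimizers_dist_sq_le[OF C(2) that[unfolded N_def]] n by linarith
      qed (use \<open>e > 0\<close> in simp)
      then show ?thesis by blast
    qed
  qed blast
  have "(dist x p)\<^sup>2 \<le> (infdist x C)\<^sup>2 + e" if "e > 0" for e
  proof -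
    obtain n where "inverse (real (Suc n)) < e" using reals_Archimedean \<open>e > 0\<close> by blast
    then show ?thesis using p[of n] by (simp add: N_def near_minimizers_def)
  qed
  then have "(dist x p)\<^sup>2 \<le> (infdist x C)\<^sup>2" by (rule field_le_epsilon)
  then have "dist x p \<le> infdist x C" by (rule power2_le_imp_le) (rule infdist_nonneg)
  then show ?thesis
    using p infdist_le[of p C x] that by (force simp: N_def near_minimizers_def)
qed

lemma orthogonal_projection_exists:
  fixes M :: "'a::chilbert set"
  assumes M: "cvs.subspace M" "closed M"
  obtains p where "p \<in> M" "x - p \<in> orthogonal_complement M"
proof -
  obtain p where p: "p \<in> M" "dist x p = infdist x M"
    using infdist_attains_inf_convex[OF M(2) convex_subspace[OF M(1)]] cvs.subspace_0[OF M(1)]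
    by blast
  have "cinner (x - p) q = 0" if q: "q \<in> M" for q
  proof (cases "q = 0")
    case False
    define c where "c = cinner (x - p) q / (norm q)\<^sup>2"
    have "p + c *\<^sub>C q \<in> M" by (intro cvs.subspace_add cvs.subspace_scale M p q)
    then have "dist x p \<le> dist x (p + c *\<^sub>C q)" unfolding p(2) by (rule infdist_le)
    then have "norm (x - p) \<le> norm ((x - p) - c *\<^sub>C q)"
      by (simp add: dist_norm algebra_simps)
    then have "(norm (x - p))\<^sup>2 \<le> (norm ((x - p) - c *\<^sub>C q))\<^sup>2" by (rule power_mono) simp
    then show ?thesis using False unfolding c_def norm_diff_projection_sq[OF False] by simp
  qed simp
  then show ?thesis using that p(1) by (simp add: orthogonal_complement_def)
qed

lemma double_orthogonal_complement_subset_closure: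
  fixes M :: "'a::chilbert set"
  assumes M: "cvs.subspace M"
  shows "orthogonal_complement (orthogonal_complement M) \<subseteq> closure M"
proof
  fix x assume x: "x \<in> orthogonal_complement (orthogonal_complement M)"
  obtain p where p: "p \<in> closure M" "x - p \<in> orthogonal_complement (closure M)"
    using orthogonal_projection_exists[OF subspace_closure[OF M] closed_closure] by blast
  have "x - p \<in> orthogonal_complement M"
    using p(2) closure_subset[of M] by (auto simp: orthogonal_complement_def)
  then have "cinner x (x - p) = 0" using x orthogonal_complementD by blast
  moreover have "cinner (x - p) p = 0" using p orthogonal_complementD by blast
  then have "cinner p (x - p) = 0" by (metis cinner_commute complex_cnj_zero)
  ultimately have "cinner (x - p) (x - p) = 0" by (simp add: cinner.diff_left)
  then show "x \<in> closure M" using p(1) by simp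
qed

section \<open>Orthonormal families and finite dimension\<close>

definition orthonormal_on :: "'i set \<Rightarrow> ('i \<Rightarrow> 'a::chilbert) \<Rightarrow> bool" where
  "orthonormal_on I e \<longleftrightarrow> (\<forall>i\<in>I. \<forall>j\<in>I. cinner (e i) (e j) = of_bool (i = j))"

lemma orthonormal_onI:
  fixes e :: "'i::linorder \<Rightarrow> 'a::chilbert"
  assumes "\<And>i. i \<in> I \<Longrightarrow> norm (e i) = 1"
    and less: "\<And>i j. i \<in> I \<Longrightarrow> j \<in> I \<Longrightarrow> i < j \<Longrightarrow> cinner (e j) (e i) = 0"
  shows "orthonormal_on I e"
  unfolding orthonormal_on_def
proof (intro ballI)
  fix i j assume "i \<in> I" "j \<in> I"
  then show "cinner (e i) (e j) = of_bool (i = j)"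
    using assms norm_cinner[of "e i"] cinner_commute[of "e i" "e j"]
    by (cases i j rule: linorder_cases) auto
qed

lemma orthonormal_on_norm: "orthonormal_on I e \<Longrightarrow> i \<in> I \<Longrightarrow> norm (e i) = 1"
  using norm_sq_eq_cinner[of "e i"] power2_eq_1_iff[of "norm (e i)"] norm_ge_zero[of "e i"]
  by (simp add: orthonormal_on_def)

lemma orthonormal_on_dist:
  assumes "orthonormal_on I e" "i \<in> I" "j \<in> I" "i \<noteq> j"
  shows "dist (e i) (e j) = sqrt 2"
proof -
  have "(dist (e i) (e j))\<^sup>2 = 2"
    using assms
    by (simp add: dist_norm norm_diff_sq orthonormal_on_norm) (simp add: orthonormal_on_def)
  then show ?thesis by (metis real_sqrt_unique zero_le_dist)
qed

lemma cinner_sum_orthonormal: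
  assumes "finite I" "orthonormal_on I e" "j \<in> I"
  shows "cinner (\<Sum>i\<in>I. c i *\<^sub>C e i) (e j) = c j"
proof -
  have "cinner (\<Sum>i\<in>I. c i *\<^sub>C e i) (e j) = (\<Sum>i\<in>I. if i = j then c i else 0)"
    unfolding cinner.sum_left cinner_scaleC_left
    using assms by (intro sum.cong) (auto simp: orthonormal_on_def)
  then show ?thesis using assms(1,3) by simp
qed

lemma orthonormal_imp_cindependent:
  assumes "finite I" "orthonormal_on I e"
  shows "inj_on e I" "cindependent (e ` I)"
proof -
  show inj: "inj_on e I"
    using assms(2) orthonormal_on_dist[of I e] by (force intro!: inj_onI)
  show "cindependent (e ` I)"
    unfolding cindependent_def sum.reindex[OF inj] o_def
  proof (intro allI impI ballI)
    fix c x assume c: "(\<Sum>i\<in>I. c (e i) *\<^sub>C e i) = 0" and "x \<in> e ` I"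
    then obtain i where i: "i \<in> I" "x = e i" by blast
    show "c x = 0"
      using cinner_sum_orthonormal[OF assms i(1), of "\<lambda>i. c (e i)"] unfolding c i(2) by simp
  qed
qed

lemma orthonormal_extend:
  assumes M: "cvs.subspace M" and e: "e ` I \<subseteq> M" "finite I" "orthonormal_on I e"
    and x: "x \<in> M" "(\<Sum>i\<in>I. cinner x (e i) *\<^sub>C e i) \<noteq> x"
  obtains v where "v \<in> M" "norm v = 1" "\<And>i. i \<in> I \<Longrightarrow> cinner v (e i) = 0"
proof
  define y where "y = x - (\<Sum>i\<in>I. cinner x (e i) *\<^sub>C e i)"
  have "y \<in> M"
    unfolding y_def using e(1)
    by (intro cvs.subspace_diff cvs.subspace_sum cvs.subspace_scale M x) auto
  then show "sgn y \<in> M" unfolding sgn_div_norm by (intro scaleR_mem_subspace M)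
  show "norm (sgn y) = 1" using x(2) by (simp add: norm_sgn y_def)
  show "cinner (sgn y) (e i) = 0" if "i \<in> I" for i
    unfolding y_def sgn_div_norm cinner.scaleR_left cinner.diff_left
      cinner_sum_orthonormal[OF e(2,3) that] by simp
qed

lemma orthonormal_sequence_or_basis:
  assumes M: "cvs.subspace M"
  obtains (sequence) e :: "nat \<Rightarrow> 'a::chilbert" where "range e \<subseteq> M" "orthonormal_on UNIV e"
  | (basis) n and e :: "nat \<Rightarrow> 'a::chilbert" where "e ` {..<n} \<subseteq> M" "orthonormal_on {..<n} e"
      "\<And>x. x \<in> M \<Longrightarrow> (\<Sum>i<n. cinner x (e i) *\<^sub>C e i) = x"
proof -
  define is_basis where "is_basis n e \<longleftrightarrow> e ` {..<n} \<subseteq> M \<and> orthonormal_on {..<n} e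
      \<and> (\<forall>x\<in>M. (\<Sum>i<n. cinner x (e i) *\<^sub>C e i) = x)" for n and e :: "nat \<Rightarrow> 'a"
  show ?thesis
  proof (cases "\<exists>n e. is_basis n e")
    case True
    then obtain n e where "is_basis n e" by blast
    then show ?thesis by (intro basis[of e n]) (simp_all add: is_basis_def)
  next
    case False
    define extends where "extends e n v \<longleftrightarrow> v \<in> M \<and> norm v = 1 \<and> (\<forall>i<n. cinner v (e i) = 0)"
      for e :: "nat \<Rightarrow> 'a" and n v
    have "\<exists>e. \<forall>n. extends e n (e n)"
    proof (rule dependent_wellorder_choice)
      show "\<exists>v. extends e n v" if "\<And>j. j < n \<Longrightarrow> extends e j (e j)" for n e
      proof -
        have on: "e ` {..<n} \<subseteq> M" "orthonormal_on {..<n} e"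
          using that by (auto simp: extends_def intro: orthonormal_onI)
        then obtain x where x: "x \<in> M" "(\<Sum>i<n. cinner x (e i) *\<^sub>C e i) \<noteq> x"
          using False unfolding is_basis_def by blast
        show ?thesis
          by (rule orthonormal_extend[OF M on(1) finite_lessThan on(2) x])
            (auto simp: extends_def)
      qed
    qed (simp add: extends_def)
    then obtain e where e: "\<And>n. extends e n (e n)" by blast
    show ?thesis
    proof (rule sequence[of e])
      show "range e \<subseteq> M" using e by (auto simp: extends_def)
      show "orthonormal_on UNIV e" using e by (intro orthonormal_onI) (auto simp: extends_def)
    qed
  qed
qed

lemma infinite_dim_imp_orthonormal_sequence:
  assumes M: "cvs.subspace M" and inf: "infinite_dim M"
  obtains e :: "nat \<Rightarrow> 'a::chilbert" where "range e \<subseteq> M" "orthonormal_on UNIV e"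
  using M
proof (cases rule: orthonormal_sequence_or_basis)
  case (basis n e)
  obtain G where G: "G \<subseteq> M" "finite G" "card G = Suc n" "cindependent G"
    using inf unfolding infinite_dim_def by blast
  have "(\<Sum>i<n. cinner x (e i) *\<^sub>C e i) \<in> cvs.span (e ` {..<n})" for x
    by (intro cvs.span_sum cvs.span_scale cvs.span_base) auto
  then have "G \<subseteq> cvs.span (e ` {..<n})" using basis(3) G(1) by (metis subset_iff)
  moreover have "cvs.independent G"
    using G(2,4) by (auto simp: cvs.independent_if_scalars_zero cindependent_def)
  ultimately have "card G \<le> card (e ` {..<n})"
    using cvs.independent_span_bound[of "e ` {..<n}" G] by blast
  also have "\<dots> \<le> n" using card_image_le[of "{..<n}" e] by simp
  finally show ?thesis using G(3) by simp
qed blast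

lemma finite_dim_imp_orthonormal_basis:
  assumes M: "cvs.subspace M" and fin: "\<not> infinite_dim M"
  obtains n and e :: "nat \<Rightarrow> 'a::chilbert" where "e ` {..<n} \<subseteq> M" "orthonormal_on {..<n} e"
      "\<And>x. x \<in> M \<Longrightarrow> (\<Sum>i<n. cinner x (e i) *\<^sub>C e i) = x"
  using M
proof (cases rule: orthonormal_sequence_or_basis)
  case (sequence e)
  have "\<exists>F\<subseteq>M. finite F \<and> card F = n \<and> cindependent F" for n
  proof (intro exI conjI)
    have on: "orthonormal_on {..<n} e" using sequence(2) by (auto simp: orthonormal_on_def)
    show "e ` {..<n} \<subseteq> M" "finite (e ` {..<n})" using sequence(1) by auto
    show "card (e ` {..<n}) = n" "cindependent (e ` {..<n})"
      using orthonormal_imp_cindependent[OF _ on] by (simp_all add: card_image)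
  qed
  then show ?thesis using fin by (simp add: infinite_dim_def)
qed blast

lemma compact_bounded_combinations:
  fixes e :: "nat \<Rightarrow> 'a::chilbert"
  shows "compact {\<Sum>i<n. c i *\<^sub>C e i | c. \<forall>i<n. cmod (c i) \<le> b}"
proof (induction n)
  case (Suc n)
  let ?K = "\<lambda>n. {\<Sum>i<n. c i *\<^sub>C e i | c. \<forall>i<n. cmod (c i) \<le> b}"
    and ?L = "(\<lambda>z. z *\<^sub>C e n) ` cball 0 b"
  have "compact ?L"
    by (intro compact_continuous_image compact_cball scaleC.continuous_on continuous_intros)
  then have "compact {x + y | x y. x \<in> ?K n \<and> y \<in> ?L}"
    by (rule compact_sums[OF Suc.IH])
  also have "{x + y | x y. x \<in> ?K n \<and> y \<in> ?L} = ?K (Suc n)"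
  proof (intro equalityI subsetI)
    fix v assume "v \<in> {x + y | x y. x \<in> ?K n \<and> y \<in> ?L}"
    then obtain c z where c: "\<forall>i<n. cmod (c i) \<le> b" "cmod z \<le> b"
      and v: "v = (\<Sum>i<n. c i *\<^sub>C e i) + z *\<^sub>C e n" by auto
    show "v \<in> ?K (Suc n)"
      using c v by (intro CollectI exI[of _ "c(n := z)"]) (auto simp: less_Suc_eq)
  next
    fix v assume "v \<in> ?K (Suc n)"
    then obtain c where c: "\<forall>i<Suc n. cmod (c i) \<le> b" and v: "v = (\<Sum>i<Suc n. c i *\<^sub>C e i)"
      by blast
    then have "(\<Sum>i<n. c i *\<^sub>C e i) \<in> ?K n" "c n *\<^sub>C e n \<in> ?L" by auto
    then show "v \<in> {x + y | x y. x \<in> ?K n \<and> y \<in> ?L}" unfolding v sum.lessThan_Suc by blast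
  qed
  finally show ?case .
qed simp

lemma finite_dim_convergent_subsequence:
  fixes x :: "nat \<Rightarrow> 'a::chilbert"
  assumes M: "cvs.subspace M" "\<not> infinite_dim M"
    and x: "\<And>n. x n \<in> M" "bounded (range x)"
  obtains r where "strict_mono (r::nat \<Rightarrow> nat)" "convergent (x \<circ> r)"
proof -
  obtain m and e :: "nat \<Rightarrow> 'a" where e: "orthonormal_on {..<m} e"
    and expansion: "\<And>x. x \<in> M \<Longrightarrow> (\<Sum>i<m. cinner x (e i) *\<^sub>C e i) = x"
    by (rule finite_dim_imp_orthonormal_basis[OF M]) (rule that)
  obtain b where b: "\<And>n. norm (x n) \<le> b" using x(2) by (auto simp: bounded_iff)
  have "cmod (cinner (x n) (e i)) \<le> b" if "i < m" for n i
    using Cauchy_Schwarz_cinner[of "x n" "e i"] orthonormal_on_norm[OF e, of i] b[of n] that by simp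
  then have "x n \<in> {\<Sum>i<m. c i *\<^sub>C e i | c. \<forall>i<m. cmod (c i) \<le> b}" for n
    using expansion[OF x(1), of n, symmetric]
    by (intro CollectI exI[of _ "\<lambda>i. cinner (x n) (e i)"]) simp
  then show ?thesis
    using compact_bounded_combinations[of e m b] that unfolding compact_def convergent_def by meson
qed

lemma infinite_dim_imp_nonzero:
  assumes "infinite_dim M"
  obtains x where "x \<in> M" "x \<noteq> 0"
proof -
  obtain F where "F \<subseteq> M" "card F = 1" "cindependent F" using assms infinite_dim_def by metis
  moreover have "0 \<notin> F" if "card F = 1" "cindependent F"
    using that by (auto simp: card_1_singleton_iff cindependent_def)
  ultimately show ?thesis using that by (force simp: card_1_singleton_iff)
qed

section \<open>Linear relations and their operator parts\<close>

lemma lin_rel_zero: "lin_rel T \<Longrightarrow> (0, 0) \<in> T"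
  by (simp add: lin_rel_def)

lemma lin_rel_add: "lin_rel T \<Longrightarrow> (x, f) \<in> T \<Longrightarrow> (y, g) \<in> T \<Longrightarrow> (x + y, f + g) \<in> T"
  by (simp add: lin_rel_def)

lemma lin_rel_scaleC: "lin_rel T \<Longrightarrow> (x, f) \<in> T \<Longrightarrow> (c *\<^sub>C x, c *\<^sub>C f) \<in> T"
  by (simp add: lin_rel_def)

lemma lin_rel_scaleR: "lin_rel T \<Longrightarrow> (x, f) \<in> T \<Longrightarrow> (r *\<^sub>R x, r *\<^sub>R f) \<in> T"
  by (simp add: scaleR_scaleC lin_rel_scaleC)

lemma lin_rel_diff: "lin_rel T \<Longrightarrow> (x, f) \<in> T \<Longrightarrow> (y, g) \<in> T \<Longrightarrow> (x - y, f - g) \<in> T"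
  using lin_rel_add[of T x f "- y" "- g"] lin_rel_scaleR[of T y g "- 1"] by simp

lemma closed_rel_limit:
  assumes "closed T" "\<And>n. (x n, f n) \<in> T" "x \<longlonglongrightarrow> a" "f \<longlonglongrightarrow> b"
  shows "(a, b) \<in> T"
  using closed_sequentially[OF assms(1) assms(2) tendsto_Pair[OF assms(3,4)]] .

definition mul_part :: "'a::chilbert rel2 \<Rightarrow> 'a set" where
  "mul_part T = {g. (0, g) \<in> T}"

lemma subspace_mul_part: "lin_rel T \<Longrightarrow> cvs.subspace (mul_part T)"
  using lin_rel_zero[of T] lin_rel_add[of T 0 _ 0] lin_rel_scaleC[of T 0]
  by (auto simp: cvs.subspace_def mul_part_def)

lemma closed_mul_part:
  assumes "closed T"
  shows "closed (mul_part T)"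
proof -
  have "mul_part T = Pair 0 -` T" by (auto simp: mul_part_def)
  then show ?thesis using assms by (simp add: closed_vimage continuous_intros)
qed

lemma subspace_rdom: "lin_rel T \<Longrightarrow> cvs.subspace (rdom T)"
  unfolding cvs.subspace_def rdom_def
  using lin_rel_zero[of T] lin_rel_add[of T] lin_rel_scaleC[of T] by blast

lemma mem_op_part_iff:
  "(x, s) \<in> op_part T \<longleftrightarrow> (x, s) \<in> T \<and> s \<in> orthogonal_complement (mul_part T)"
  by (auto simp: op_part_def rel_inf_def pinner_def mul_part_def orthogonal_complement_def)

lemma lin_rel_op_part: "lin_rel T \<Longrightarrow> lin_rel (op_part T)"
  by (simp add: lin_rel_def mem_op_part_iff orthogonal_complement_def cinner_simps)

lemma closed_op_part:
  assumes "closed T"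
  shows "closed (op_part T)"
proof -
  have "op_part T = T \<inter> UNIV \<times> orthogonal_complement (mul_part T)"
    by (auto simp: mem_op_part_iff)
  then show ?thesis
    using closed_Int[OF assms closed_Times[OF closed_UNIV closed_orthogonal_complement]] by simp
qed

lemma op_part_single_valued:
  assumes T: "lin_rel T" and s: "(x, s) \<in> op_part T" "(x, s') \<in> op_part T"
  shows "s = s'"
proof -
  have "(0, s - s') \<in> op_part T" using lin_rel_diff[OF lin_rel_op_part[OF T] s] by simp
  then have "cinner (s - s') (s - s') = 0"
    unfolding mem_op_part_iff mul_part_def orthogonal_complement_def by blast
  then show ?thesis by simp
qed

lemma op_part_decomposition:
  assumes T: "lin_rel T" "closed T" and xf: "(x, f) \<in> T"
  obtains s where "(x, s) \<in> op_part T" "f - s \<in> mul_part T"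
proof -
  obtain p where p: "p \<in> mul_part T" "f - p \<in> orthogonal_complement (mul_part T)"
    using orthogonal_projection_exists[OF subspace_mul_part closed_mul_part] T by blast
  have "(x, f - p) \<in> op_part T"
    using lin_rel_diff[OF T(1) xf, of 0 p] p by (simp add: mem_op_part_iff mul_part_def)
  then show ?thesis using p(1) by (intro that[of "f - p"]) simp_all
qed

definition op_fun :: "'a::chilbert rel2 \<Rightarrow> 'a \<Rightarrow> 'a" where
  "op_fun T x = (THE s. (x, s) \<in> op_part T)"

lemma op_fun_eq: "lin_rel T \<Longrightarrow> (x, s) \<in> op_part T \<Longrightarrow> op_fun T x = s"
  unfolding op_fun_def by (blast intro: op_part_single_valued)

lemma op_fun_mem_op_part:
  assumes "lin_rel T" "closed T" "x \<in> rdom T"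
  shows "(x, op_fun T x) \<in> op_part T"
  using assms op_part_decomposition op_fun_eq unfolding rdom_def by blast

lemma op_fun_mem: "lin_rel T \<Longrightarrow> closed T \<Longrightarrow> x \<in> rdom T \<Longrightarrow> (x, op_fun T x) \<in> T"
  using op_fun_mem_op_part mem_op_part_iff by blast

lemma op_fun_diff:
  assumes "lin_rel T" "closed T" "x \<in> rdom T" "y \<in> rdom T"
  shows "op_fun T (x - y) = op_fun T x - op_fun T y"
  using assms by (intro op_fun_eq lin_rel_diff lin_rel_op_part op_fun_mem_op_part)

lemma op_fun_scaleR:
  assumes "lin_rel T" "closed T" "x \<in> rdom T"
  shows "op_fun T (r *\<^sub>R x) = r *\<^sub>R op_fun T x"
  using assms by (intro op_fun_eq lin_rel_scaleR lin_rel_op_part op_fun_mem_op_part)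

lemma norm_op_fun_le:
  assumes T: "lin_rel T" "closed T" and xf: "(x, f) \<in> T"
  shows "norm (op_fun T x) \<le> norm f"
proof -
  obtain s where s: "(x, s) \<in> op_part T" "f - s \<in> mul_part T"
    using op_part_decomposition[OF T xf] .
  then have "cinner s (f - s) = 0" by (meson mem_op_part_iff orthogonal_complementD)
  then show ?thesis
    using norm_le_norm_add_orthogonal(1)[of s "f - s"] op_fun_eq[OF T(1) s(1)] by simp
qed

lemma op_fun_limit_zero:
  assumes T: "lin_rel T" "closed T" and x: "\<And>n. x n \<in> rdom T" "x \<longlonglongrightarrow> 0"
    and g: "(\<lambda>n. op_fun T (x n)) \<longlonglongrightarrow> g"
  shows "g = 0"
proof -
  have "(0, g) \<in> op_part T"
    using closed_rel_limit[OF closed_op_part[OF T(2)] op_fun_mem_op_part[OF T x(1)] x(2) g] .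
  moreover have "(0, 0) \<in> op_part T" by (intro lin_rel_zero lin_rel_op_part T)
  ultimately show ?thesis by (rule op_part_single_valued[OF T(1)])
qed

definition bounded_rel :: "'a::chilbert rel2 \<Rightarrow> bool" where
  "bounded_rel R \<longleftrightarrow> (\<exists>K. \<forall>(y, x)\<in>R. norm x \<le> K * norm y)"

lemma bounded_relI: "(\<And>y x. (y, x) \<in> R \<Longrightarrow> norm x \<le> K * norm y) \<Longrightarrow> bounded_rel R"
  unfolding bounded_rel_def by blast

lemma bounded_relE:
  assumes "bounded_rel R"
  obtains K where "K > 0" "\<And>y x. (y, x) \<in> R \<Longrightarrow> norm x \<le> K * norm y"
proof -
  obtain K where K: "\<And>y x. (y, x) \<in> R \<Longrightarrow> norm x \<le> K * norm y"
    using assms unfolding bounded_rel_def by blast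
  have "norm x \<le> max K 1 * norm y" if "(y, x) \<in> R" for y x
    using K[OF that] mult_right_mono[of K "max K 1" "norm y"] by simp
  then show ?thesis by (intro that[of "max K 1"]) auto
qed

lemma bounded_rel_convergent:
  assumes R: "lin_rel R" "bounded_rel R" and wx: "\<And>n. (w n, x n) \<in> R" and w: "convergent w"
  shows "convergent x"
proof -
  obtain K where K: "K > 0" "\<And>y x. (y, x) \<in> R \<Longrightarrow> norm x \<le> K * norm y"
    using bounded_relE[OF R(2)] by metis
  have "Cauchy x"
  proof (rule CauchyI)
    fix e :: real assume "e > 0"
    then obtain N where N: "\<And>m n. m \<ge> N \<Longrightarrow> n \<ge> N \<Longrightarrow> norm (w m - w n) < e / K"
      using CauchyD[OF convergent_Cauchy[OF w], of "e / K"] K(1) by auto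
    have "norm (x m - x n) < e" if "m \<ge> N" "n \<ge> N" for m n
    proof -
      have "norm (x m - x n) \<le> K * norm (w m - w n)" by (intro K(2) lin_rel_diff R wx)
      also have "\<dots> < e" using N[OF that] K(1) by (simp add: pos_less_divide_eq mult.commute)
      finally show ?thesis .
    qed
    then show "\<exists>N. \<forall>m\<ge>N. \<forall>n\<ge>N. norm (x m - x n) < e" by blast
  qed
  then show ?thesis by (rule Cauchy_convergent)
qed

lemma closed_rdom:
  assumes R: "lin_rel R" "closed R" "bounded_rel R"
  shows "closed (rdom R)"
  unfolding closed_sequential_limits
proof (intro allI impI, elim conjE)
  fix w a assume "\<forall>n. w n \<in> rdom R" and w: "w \<longlonglongrightarrow> a"
  then obtain x where wx: "\<And>n. (w n, x n) \<in> R" unfolding rdom_def by simp metis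
  obtain b where "x \<longlonglongrightarrow> b"
    using bounded_rel_convergent[OF R(1,3) wx convergentI[OF w]] unfolding convergent_def by blast
  then have "(a, b) \<in> R" by (rule closed_rel_limit[OF R(2) wx w])
  then show "a \<in> rdom R" by (auto simp: rdom_def)
qed

lemma not_bounded_rel_sequence:
  assumes R: "lin_rel R" and unbounded: "\<not> bounded_rel R"
  obtains w x where "\<And>n. (w n, x n) \<in> R" "\<And>n. norm (x n) = 1" "w \<longlonglongrightarrow> 0"
proof -
  have "\<exists>w x. (w, x) \<in> R \<and> norm x = 1 \<and> norm w \<le> inverse (real (Suc n))" for n
  proof -
    obtain y x where yx: "(y, x) \<in> R" "real (Suc n) * norm y < norm x"
      using unbounded unfolding bounded_rel_def by (force simp: not_le)
    have "0 \<le> real (Suc n) * norm y" by simp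
    then have x: "norm x > 0" using yx(2) by linarith
    have "(inverse (norm x) *\<^sub>R y, inverse (norm x) *\<^sub>R x) \<in> R" by (rule lin_rel_scaleR[OF R yx(1)])
    moreover have "norm (inverse (norm x) *\<^sub>R y) \<le> inverse (real (Suc n))"
      using yx(2) x by (simp add: field_simps)
    ultimately show ?thesis using x by (intro exI[of _ "inverse (norm x) *\<^sub>R _"] conjI) auto
  qed
  then obtain w x where wx: "\<And>n. (w n, x n) \<in> R" "\<And>n. norm (x n) = 1"
    and w: "\<And>n. norm (w n) \<le> inverse (real (Suc n))" by metis
  have "w \<longlonglongrightarrow> 0"
    by (rule Lim_null_comparison[OF always_eventually LIMSEQ_inverse_real_of_nat])
      (use w in blast)
  then show ?thesis using that wx by blast
qed

text \<open>For \<open>R = (l - T)\<^sup>-\<^sup>1\<close> this says that \<open>l - T\<close> is proper on bounded sets; it fails exactly when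
  there is a singular sequence in the sense of Weyl.\<close>

definition proper_inverse :: "'a::chilbert rel2 \<Rightarrow> bool" where
  "proper_inverse R \<longleftrightarrow> (\<forall>w x. (\<forall>n. (w n, x n) \<in> R) \<longrightarrow> convergent w \<longrightarrow> bounded (range x) \<longrightarrow>
     (\<exists>r. strict_mono (r::nat \<Rightarrow> nat) \<and> convergent (x \<circ> r)))"

lemma proper_inverseE:
  assumes "proper_inverse R" "\<And>n. (w n, x n) \<in> R" "convergent w" "bounded (range x)"
  obtains r a where "strict_mono (r::nat \<Rightarrow> nat)" "(\<lambda>n. x (r n)) \<longlonglongrightarrow> a"
  using assms unfolding proper_inverse_def convergent_def o_def by metis

lemma proper_inverse_subsequenceI:
  assumes proper: "proper_inverse R'"
    and perturb: "\<And>w x. (\<And>n. (w n, x n) \<in> R) \<Longrightarrow> convergent w \<Longrightarrow> bounded (range x) \<Longrightarrow>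
      \<exists>r v. strict_mono (r::nat \<Rightarrow> nat) \<and> convergent v \<and> (\<forall>n. (v n, x (r n)) \<in> R')"
  shows "proper_inverse R"
  unfolding proper_inverse_def
proof (intro allI impI)
  fix w x assume wx: "\<forall>n. (w n, x n) \<in> R" and w: "convergent w" and x: "bounded (range x)"
  then obtain r v where r: "strict_mono (r::nat \<Rightarrow> nat)"
    and v: "convergent v" "\<And>n. (v n, x (r n)) \<in> R'"
    using perturb[of w x] by blast
  have "bounded (range (\<lambda>n. x (r n)))" by (rule bounded_subset[OF x]) auto
  then obtain q a where q: "strict_mono (q::nat \<Rightarrow> nat)" "(\<lambda>n. x (r (q n))) \<longlonglongrightarrow> a"
    by (rule proper_inverseE[OF proper v(2,1)])
  then show "\<exists>r. strict_mono (r::nat \<Rightarrow> nat) \<and> convergent (x \<circ> r)"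
    using strict_mono_o[OF r q(1)] by (auto simp: convergent_def o_def)
qed

lemma proper_inverse_imp_finite_dim:
  assumes R: "lin_rel R" and proper: "proper_inverse R"
  shows "\<not> infinite_dim (mul_part R)"
proof
  assume "infinite_dim (mul_part R)"
  then obtain e :: "nat \<Rightarrow> 'a" where e: "range e \<subseteq> mul_part R" and on: "orthonormal_on UNIV e"
    using infinite_dim_imp_orthonormal_sequence[OF subspace_mul_part[OF R]] by metis
  have "(0, e n) \<in> R" for n using e by (auto simp: mul_part_def)
  moreover have "bounded (range e)" using orthonormal_on_norm[OF on] by (auto simp: bounded_iff)
  ultimately obtain r a where r: "strict_mono r" "(\<lambda>n. e (r n)) \<longlonglongrightarrow> a"
    using proper_inverseE[OF proper, of "\<lambda>_. 0"] convergent_const by metis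
  obtain N where N: "\<And>m n. m \<ge> N \<Longrightarrow> n \<ge> N \<Longrightarrow> dist (e (r m)) (e (r n)) < 1"
    using LIMSEQ_imp_Cauchy[OF r(2)] unfolding Cauchy_def by (meson zero_less_one)
  have "r N \<noteq> r (Suc N)" using strict_monoD[OF r(1), of N "Suc N"] by simp
  then have "sqrt 2 < 1" using N[of N "Suc N"] orthonormal_on_dist[OF on] by simp
  then show False by simp
qed

lemma proper_inverse_imp_bounded_op_part:
  assumes R: "lin_rel R" "closed R" and proper: "proper_inverse R"
  shows "bounded_rel (op_part R)"
proof (rule ccontr)
  assume "\<not> bounded_rel (op_part R)"
  then obtain w x where wx: "\<And>n. (w n, x n) \<in> op_part R" "\<And>n. norm (x n) = 1" and w: "w \<longlonglongrightarrow> 0"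
    using not_bounded_rel_sequence[OF lin_rel_op_part[OF R(1)]] by metis
  obtain r a where r: "strict_mono r" "(\<lambda>n. x (r n)) \<longlonglongrightarrow> a"
    using proper_inverseE[OF proper, of w x] wx w
    by (metis bounded_iff convergentI mem_op_part_iff order_refl rangeE)
  have "(\<lambda>n. w (r n)) \<longlonglongrightarrow> 0" using LIMSEQ_subseq_LIMSEQ[OF w r(1)] by (simp add: o_def)
  then have "(0, a) \<in> op_part R"
    using closed_rel_limit[OF closed_op_part[OF R(2)] wx(1) _ r(2)] by blast
  then have "a = 0"
    using op_part_single_valued[OF R(1)] lin_rel_zero[OF lin_rel_op_part[OF R(1)]] by blast
  moreover have "norm a = 1" using tendsto_norm[OF r(2)] wx(2) by (simp add: LIMSEQ_const_iff)
  ultimately show False by simp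
qed

lemma proper_inverseI:
  assumes R: "lin_rel R" "closed R" and fin: "\<not> infinite_dim (mul_part R)"
    and bdd: "bounded_rel (op_part R)"
  shows "proper_inverse R"
  unfolding proper_inverse_def
proof (intro allI impI)
  fix w x assume wx: "\<forall>n. (w n, x n) \<in> R" and w: "convergent w" and x: "bounded (range x)"
  have "\<exists>s. (w n, s) \<in> op_part R \<and> x n - s \<in> mul_part R" for n
    using op_part_decomposition[OF R wx[rule_format, of n]] by blast
  then obtain s where s: "\<And>n. (w n, s n) \<in> op_part R" "\<And>n. x n - s n \<in> mul_part R" by metis
  have "convergent s" by (rule bounded_rel_convergent[OF lin_rel_op_part[OF R(1)] bdd s(1) w])
  then have "bounded (range (\<lambda>n. x n - s n))"
    using x convergent_imp_bounded by (intro bounded_minus_comp) (auto simp: convergent_def)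
  then obtain r where r: "strict_mono (r::nat \<Rightarrow> nat)" "convergent ((\<lambda>n. x n - s n) \<circ> r)"
    using finite_dim_convergent_subsequence[of _ "\<lambda>n. x n - s n",
        OF subspace_mul_part[OF R(1)] fin s(2)]
    by blast
  have "convergent (s \<circ> r)" by (rule convergent_subseq_convergent[OF \<open>convergent s\<close> r(1)])
  from convergent_add[OF r(2) this] have "convergent (x \<circ> r)" by (simp add: o_def)
  then show "\<exists>r. strict_mono (r::nat \<Rightarrow> nat) \<and> convergent (x \<circ> r)" using r(1) by blast
qed

lemma proper_inverse_iff:
  assumes "lin_rel R" "closed R"
  shows "proper_inverse R \<longleftrightarrow> \<not> infinite_dim (mul_part R) \<and> bounded_rel (op_part R)"
  using assms proper_inverse_imp_finite_dim proper_inverse_imp_bounded_op_part proper_inverseI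
  by blast

section \<open>Relative compactness and relative boundedness\<close>

definition relatively_bounded :: "'a::chilbert rel2 \<Rightarrow> 'a rel2 \<Rightarrow> real \<Rightarrow> real \<Rightarrow> bool" where
  "relatively_bounded U V a b \<longleftrightarrow>
     (\<forall>x\<in>rdom V. norm (op_fun U x) \<le> a * norm (op_fun V x) + b * norm x)"

lemma rel_compact_convergent_subsequence:
  assumes V: "lin_rel V" "closed V" and U: "lin_rel U" "closed U" and dom: "rdom V \<subseteq> rdom U"
    and compact: "rel_compact (op_part U) (op_part V)"
    and x: "\<And>n. x n \<in> rdom V" "bounded (range x)" "bounded (range (\<lambda>n. op_fun V (x n)))"
  obtains r g where "strict_mono (r::nat \<Rightarrow> nat)" "(\<lambda>n. op_fun U (x (r n))) \<longlonglongrightarrow> g"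
proof -
  obtain K L where KL: "\<And>n. norm (x n) \<le> K" "\<And>n. norm (op_fun V (x n)) \<le> L"
    using x(2,3) by (auto simp: bounded_iff)
  let ?B = "range (\<lambda>n. (x n, op_fun V (x n)))"
  let ?G = "{g. \<exists>x f. (x, f) \<in> ?B \<and> (x, g) \<in> op_part U}"
  have "?B \<subseteq> op_part V" using op_fun_mem_op_part[OF V x(1)] by blast
  moreover have "\<forall>(x, f)\<in>?B. norm x + norm f \<le> K + L" using KL by (auto intro: add_mono)
  ultimately have "compact (closure ?G)" using compact unfolding rel_compact_def by blast
  moreover have "op_fun U (x n) \<in> closure ?G" for n
    using op_fun_mem_op_part[OF U subsetD[OF dom x(1)[of n]]]
    by (intro closure_subset[THEN subsetD]) blast
  ultimately obtain g r where "strict_mono (r::nat \<Rightarrow> nat)" "((\<lambda>n. op_fun U (x n)) \<circ> r) \<longlonglongrightarrow> g"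
    unfolding compact_def by meson
  then show ?thesis using that by (simp add: o_def)
qed

lemma not_relatively_bounded_sequence:
  assumes V: "lin_rel V" "closed V" and U: "lin_rel U" "closed U" and dom: "rdom V \<subseteq> rdom U"
    and a: "a > 0" and unbounded: "\<And>b. b \<ge> 0 \<Longrightarrow> \<not> relatively_bounded U V a b"
  obtains x where "\<And>n. x n \<in> rdom V" "\<And>n. norm (op_fun U (x n)) = 1"
    "\<And>n. norm (op_fun V (x n)) \<le> 1 / a" "x \<longlonglongrightarrow> 0"
proof -
  have "\<exists>x\<in>rdom V. norm (op_fun U x) = 1 \<and> norm (op_fun V x) \<le> 1 / a
      \<and> norm x \<le> inverse (real (Suc n))" for n
  proof -
    obtain x where x: "x \<in> rdom V"
      and gt: "a * norm (op_fun V x) + real (Suc n) * norm x < norm (op_fun U x)"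
      using unbounded[of "real (Suc n)"] of_nat_0_le_iff[of "Suc n"]
      unfolding relatively_bounded_def by (meson not_le)
    let ?u = "norm (op_fun U x)"
    have nonneg: "0 \<le> a * norm (op_fun V x)" "0 \<le> real (Suc n) * norm x" using a by simp_all
    then have u: "0 < ?u" using gt by linarith
    show ?thesis
    proof (intro bexI conjI)
      show "inverse ?u *\<^sub>R x \<in> rdom V" by (intro scaleR_mem_subspace subspace_rdom V x)
      show "norm (op_fun U (inverse ?u *\<^sub>R x)) = 1"
        unfolding op_fun_scaleR[OF U subsetD[OF dom x]] using u by simp
      have "a * norm (op_fun V x) \<le> ?u" using gt nonneg by linarith
      then show "norm (op_fun V (inverse ?u *\<^sub>R x)) \<le> 1 / a"
        unfolding op_fun_scaleR[OF V x] using u a by (simp add: field_simps)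
      have "real (Suc n) * norm x \<le> ?u" using gt nonneg by linarith
      then show "norm (inverse ?u *\<^sub>R x) \<le> inverse (real (Suc n))"
        using u by (simp add: field_simps)
    qed
  qed
  then obtain x where x: "\<And>n. x n \<in> rdom V" "\<And>n. norm (op_fun U (x n)) = 1"
    "\<And>n. norm (op_fun V (x n)) \<le> 1 / a" "\<And>n. norm (x n) \<le> inverse (real (Suc n))"
    by metis
  have "x \<longlonglongrightarrow> 0"
    by (rule Lim_null_comparison[OF always_eventually LIMSEQ_inverse_real_of_nat])
      (use x(4) in blast)
  then show ?thesis using that x(1-3) by blast
qed

lemma rel_compact_imp_relatively_bounded:
  assumes V: "lin_rel V" "closed V" and U: "lin_rel U" "closed U" and dom: "rdom V \<subseteq> rdom U"
    and compact: "rel_compact (op_part U) (op_part V)" and a: "a > 0"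
  shows "\<exists>b\<ge>0. relatively_bounded U V a b"
proof (rule ccontr)
  assume "\<not> ?thesis"
  then obtain x where x: "\<And>n. x n \<in> rdom V" "\<And>n. norm (op_fun U (x n)) = 1"
    "\<And>n. norm (op_fun V (x n)) \<le> 1 / a" and lim: "x \<longlonglongrightarrow> 0"
    using not_relatively_bounded_sequence[OF V U dom a] by metis
  have "bounded (range (\<lambda>n. op_fun V (x n)))" using x(3) by (auto simp: bounded_iff)
  then obtain r g where r: "strict_mono r" "(\<lambda>n. op_fun U (x (r n))) \<longlonglongrightarrow> g"
    using rel_compact_convergent_subsequence[of V U x, OF V U dom compact x(1)]
      convergent_imp_bounded[OF lim] by blast
  have "(\<lambda>n. x (r n)) \<longlonglongrightarrow> 0"
    using LIMSEQ_subseq_LIMSEQ[OF lim r(1)] by (simp add: o_def)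
  then have "g = 0" using op_fun_limit_zero[OF U _ _ r(2)] x(1) dom by blast
  moreover have "norm g = 1" using tendsto_norm[OF r(2)] x(2) by (simp add: LIMSEQ_const_iff)
  ultimately show False by simp
qed

section \<open>Hermitian and self-adjoint relations\<close>

lemma hermitianD: "hermitian T \<Longrightarrow> (x, f) \<in> T \<Longrightarrow> (y, g) \<in> T \<Longrightarrow> cinner g x = cinner y f"
  by (auto simp: hermitian_def radjoint_def)

lemma selfadjoint_imp_hermitian: "selfadjoint T \<Longrightarrow> hermitian T"
  by (simp add: selfadjoint_def hermitian_def)

lemma closed_radjoint: "closed (radjoint T)"
proof -
  have "radjoint T = (\<Inter>q\<in>T. {p. cinner (snd p) (fst q) = cinner (fst p) (snd q)})"
    by (force simp: radjoint_def)
  then show ?thesis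
    by (simp add: closed_INT closed_Collect_eq cinner.continuous_on continuous_intros)
qed

lemma selfadjoint_imp_closed: "selfadjoint T \<Longrightarrow> closed T"
  by (metis selfadjoint_def closed_radjoint)

lemma selfadjoint_memI:
  assumes "selfadjoint T" "\<And>x f. (x, f) \<in> T \<Longrightarrow> cinner g x = cinner y f"
  shows "(y, g) \<in> T"
proof -
  have "(y, g) \<in> radjoint T" using assms(2) by (simp add: radjoint_def)
  then show ?thesis using assms(1) by (metis selfadjoint_def)
qed

lemma hermitian_norm_shift_sq:
  assumes "hermitian T" "(x, f) \<in> T"
  shows "(norm (l *\<^sub>C x - f))\<^sup>2 = (Im l * norm x)\<^sup>2 + (norm (Re l *\<^sub>R x - f))\<^sup>2"
proof -
  let ?u = "Re l *\<^sub>R x - f" and ?v = "(\<i> * Im l) *\<^sub>C x"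
  have "cinner f x \<in> \<real>"
    using hermitianD[OF assms assms(2)] cinner_commute[of x f] by (simp add: Reals_cnj_iff)
  then have "Im (cinner ?u x) = 0"
    using norm_cinner[of x] by (simp add: cinner_simps complex_is_Real_iff flip: norm_cinner)
  then have "Re (cinner ?u ?v) = 0" by (simp add: cinner_scaleC_right)
  then have "(norm (?u + ?v))\<^sup>2 = (Im l * norm x)\<^sup>2 + (norm ?u)\<^sup>2"
    by (simp add: norm_add_sq norm_scaleC norm_mult power_mult_distrib)
  moreover have "l *\<^sub>C x = Re l *\<^sub>R x + ?v"
    by (simp add: scaleR_scaleC scaleC_add_left[symmetric] complex_eq[symmetric])
  then have "l *\<^sub>C x - f = ?u + ?v" by simp
  ultimately show ?thesis by (simp only:)
qed

section \<open>Resolvents\<close>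

lemma mem_resolvent_rel_iff: "(w, x) \<in> resolvent_rel l T \<longleftrightarrow> (x, l *\<^sub>C x - w) \<in> T"
proof -
  have "(x, f) \<in> T \<and> w = l *\<^sub>C x - f \<longleftrightarrow> f = l *\<^sub>C x - w \<and> (x, l *\<^sub>C x - w) \<in> T" for f
    by auto
  then show ?thesis by (auto simp: resolvent_rel_def)
qed

lemma resolvent_rel_shift:
  "(w + (m - l) *\<^sub>C x, x) \<in> resolvent_rel m T \<longleftrightarrow> (w, x) \<in> resolvent_rel l T"
  by (simp add: mem_resolvent_rel_iff scaleC.diff_left)

lemma lin_rel_resolvent_rel:
  assumes "lin_rel T"
  shows "lin_rel (resolvent_rel l T)"
  unfolding lin_rel_def mem_resolvent_rel_iff
proof (intro conjI allI impI)
  fix w x v y c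
  assume wx: "(x, l *\<^sub>C x - w) \<in> T"
  show "(c *\<^sub>C x, l *\<^sub>C c *\<^sub>C x - c *\<^sub>C w) \<in> T"
    using lin_rel_scaleC[OF assms wx, of c] by (simp add: scaleC.diff_right mult.commute)
  assume vy: "(y, l *\<^sub>C y - v) \<in> T"
  show "(x + y, l *\<^sub>C (x + y) - (w + v)) \<in> T"
    using lin_rel_add[OF assms wx vy] by (simp add: algebra_simps scaleC_add_right)
qed (simp add: lin_rel_zero[OF assms])

lemma closed_resolvent_rel:
  assumes "closed T"
  shows "closed (resolvent_rel l T)"
proof -
  have "resolvent_rel l T = (\<lambda>p. (snd p, l *\<^sub>C snd p - fst p)) -` T"
    by (auto simp: mem_resolvent_rel_iff)
  then show ?thesis
    using assms by (simp add: closed_vimage scaleC.continuous_on continuous_intros)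
qed

lemma mul_part_resolvent_rel: "mul_part (resolvent_rel l T) = eigenspace T l"
  by (simp add: mul_part_def eigenspace_def mem_resolvent_rel_iff)

lemma hermitian_cinner_resolvent_rel:
  assumes "hermitian T" "(w, x) \<in> resolvent_rel l T" "(v, y) \<in> resolvent_rel (cnj l) T"
  shows "cinner w y = cinner x v"
  using hermitianD[OF assms(1), of y "cnj l *\<^sub>C y - v" x "l *\<^sub>C x - w"] assms(2,3)
  by (simp add: mem_resolvent_rel_iff cinner_simps)

lemma orthogonal_complement_rdom_resolvent_rel:
  assumes "selfadjoint T"
  shows "orthogonal_complement (rdom (resolvent_rel l T)) = eigenspace T (cnj l)"
proof (intro equalityI subsetI)
  fix u assume u: "u \<in> orthogonal_complement (rdom (resolvent_rel l T))"
  have "(u, cnj l *\<^sub>C u) \<in> T"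
  proof (rule selfadjoint_memI[OF assms])
    fix x f assume "(x, f) \<in> T"
    then have "l *\<^sub>C x - f \<in> rdom (resolvent_rel l T)" by (auto simp: rdom_def resolvent_rel_def)
    with u have "cinner u (l *\<^sub>C x - f) = 0" by (rule orthogonal_complementD)
    then show "cinner (cnj l *\<^sub>C u) x = cinner u f" by (simp add: cinner_simps)
  qed
  then show "u \<in> eigenspace T (cnj l)" by (simp add: eigenspace_def)
next
  fix u assume "u \<in> eigenspace T (cnj l)"
  then have u: "(0, u) \<in> resolvent_rel (cnj l) T"
    by (simp add: mul_part_resolvent_rel[symmetric] mul_part_def)
  have "cinner u w = 0" if "(w, x) \<in> resolvent_rel l T" for w x
    using hermitian_cinner_resolvent_rel[OF selfadjoint_imp_hermitian[OF assms] that u]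
      cinner_commute[of u w] by simp
  then show "u \<in> orthogonal_complement (rdom (resolvent_rel l T))"
    by (auto simp: orthogonal_complement_def rdom_def)
qed

lemma resolvent_set_bounded_rel: "l \<in> rel_resolvent_set T \<Longrightarrow> bounded_rel (resolvent_rel l T)"
  unfolding rel_resolvent_set_def bounded_everywhere_op_def bounded_rel_def by blast

lemma resolvent_set_rdom: "l \<in> rel_resolvent_set T \<Longrightarrow> rdom (resolvent_rel l T) = UNIV"
  by (auto simp: rel_resolvent_set_def bounded_everywhere_op_def rdom_def)

lemma hermitian_bounded_rel_resolvent_cnj:
  assumes "hermitian T" "bounded_rel (resolvent_rel l T)"
  shows "bounded_rel (resolvent_rel (cnj l) T)"
proof -
  obtain K where K: "\<And>w x. (w, x) \<in> resolvent_rel l T \<Longrightarrow> norm x \<le> K * norm w"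
    using bounded_relE[OF assms(2)] by metis
  show ?thesis
  proof (rule bounded_relI)
    fix w x assume "(w, x) \<in> resolvent_rel (cnj l) T"
    then obtain f where f: "(x, f) \<in> T" "w = cnj l *\<^sub>C x - f" by (auto simp: resolvent_rel_def)
    have "(norm (l *\<^sub>C x - f))\<^sup>2 = (norm w)\<^sup>2"
      unfolding f(2) hermitian_norm_shift_sq[OF assms(1) f(1)] by simp
    then have "norm (l *\<^sub>C x - f) = norm w" by simp
    moreover have "(l *\<^sub>C x - f, x) \<in> resolvent_rel l T"
      using f(1) by (auto simp: resolvent_rel_def)
    ultimately show "norm x \<le> K * norm w" using K by metis
  qed
qed

lemma bounded_rel_mul_part: "bounded_rel R \<Longrightarrow> mul_part R \<subseteq> {0}"
  by (force simp: bounded_rel_def mul_part_def)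

lemma selfadjoint_resolvent_setI:
  assumes T: "lin_rel T" "selfadjoint T" and bdd: "bounded_rel (resolvent_rel l T)"
  shows "l \<in> rel_resolvent_set T"
proof -
  let ?R = "resolvent_rel l T"
  have R: "lin_rel ?R" "closed ?R"
    by (intro lin_rel_resolvent_rel closed_resolvent_rel selfadjoint_imp_closed T)+
  have "orthogonal_complement (rdom ?R) \<subseteq> {0}"
    using bounded_rel_mul_part[OF hermitian_bounded_rel_resolvent_cnj[OF
        selfadjoint_imp_hermitian[OF T(2)] bdd]]
    by (simp add: orthogonal_complement_rdom_resolvent_rel[OF T(2)] mul_part_resolvent_rel)
  then have "orthogonal_complement (orthogonal_complement (rdom ?R)) = UNIV"
    by (auto simp: orthogonal_complement_def)
  then have "rdom ?R = UNIV"
    using double_orthogonal_complement_subset_closure[OF subspace_rdom[OF R(1)]]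
      closed_rdom[OF R bdd] by auto
  moreover have "x = y" if "(w, x) \<in> ?R" "(w, y) \<in> ?R" for w x y
    using lin_rel_diff[OF R(1) that] bounded_rel_mul_part[OF bdd] by (auto simp: mul_part_def)
  ultimately have "\<forall>w. \<exists>!x. (w, x) \<in> ?R" unfolding rdom_def by blast
  then show ?thesis
    using R(1) bdd by (auto simp: rel_resolvent_set_def bounded_everywhere_op_def bounded_rel_def)
qed

lemma selfadjoint_nonreal_resolvent:
  assumes T: "lin_rel T" "selfadjoint T" and l: "Im l \<noteq> 0"
  shows "l \<in> rel_resolvent_set T"
proof (rule selfadjoint_resolvent_setI[OF T bounded_relI])
  fix w x assume "(w, x) \<in> resolvent_rel l T"
  then have "(Im l * norm x)\<^sup>2 \<le> (norm w)\<^sup>2"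
    using hermitian_norm_shift_sq[OF selfadjoint_imp_hermitian[OF T(2)], of x "l *\<^sub>C x - w" l]
    by (simp add: mem_resolvent_rel_iff)
  then have "\<bar>Im l\<bar> * norm x \<le> norm w"
    using abs_le_square_iff[of "Im l * norm x" "norm w"] by (simp add: abs_mult)
  then show "norm x \<le> inverse \<bar>Im l\<bar> * norm w" using l by (simp add: field_simps)
qed

lemma hermitian_surj_imp_selfadjoint:
  assumes T: "lin_rel T" "hermitian T"
    and surj: "rdom (resolvent_rel l T) = UNIV" "rdom (resolvent_rel (cnj l) T) = UNIV"
  shows "selfadjoint T"
proof -
  have "(y, g) \<in> T" if yg: "(y, g) \<in> radjoint T" for y g
  proof -
    obtain x where x: "(l *\<^sub>C y - g, x) \<in> resolvent_rel l T"
      using surj(1) unfolding rdom_def by blast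
    define f where "f = l *\<^sub>C x - (l *\<^sub>C y - g)"
    have xf: "(x, f) \<in> T" using x by (simp add: f_def mem_resolvent_rel_iff)
    obtain z where z: "(z, cnj l *\<^sub>C z - (y - x)) \<in> T"
      using surj(2) unfolding rdom_def mem_resolvent_rel_iff by blast
    have "cinner g z = cinner y (cnj l *\<^sub>C z - (y - x))" using yg z by (simp add: radjoint_def)
    moreover have "cinner f z = cinner x (cnj l *\<^sub>C z - (y - x))" by (rule hermitianD[OF T(2) z xf])
    ultimately have "cinner (y - x) (y - x) = 0"
      by (simp add: f_def cinner_simps, algebra)
    then have "y = x" by simp
    then show ?thesis using xf by (simp add: f_def)
  qed
  then show ?thesis using T(2) by (auto simp: selfadjoint_def hermitian_def)
qed

section \<open>The essential spectrum of a self-adjoint relation\<close>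

text \<open>The operator part of \<open>(l - T)\<^sup>-\<^sup>1\<close> is bounded if and only if \<open>l - T\<close> has closed range.\<close>

definition semi_fredholm :: "'a::chilbert rel2 \<Rightarrow> complex \<Rightarrow> bool" where
  "semi_fredholm T l \<longleftrightarrow>
     \<not> infinite_dim (eigenspace T l) \<and> bounded_rel (op_part (resolvent_rel l T))"

lemma semi_fredholm_iff_proper_inverse:
  assumes "lin_rel T" "closed T"
  shows "semi_fredholm T l \<longleftrightarrow> proper_inverse (resolvent_rel l T)"
  by (simp add: semi_fredholm_def mul_part_resolvent_rel
      proper_inverse_iff[OF lin_rel_resolvent_rel[OF assms(1)] closed_resolvent_rel[OF assms(2)]])

lemma resolvent_rel_eigenspace_decomposition:
  assumes T: "lin_rel T" "closed T" "hermitian T" and wx: "(w, x) \<in> resolvent_rel m T"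
  obtains v s where "(v, s) \<in> op_part (resolvent_rel l T)"
    "norm (v + (m - l) *\<^sub>C s) \<le> norm w" "cmod (m - l) * norm (x - s) \<le> norm w"
proof -
  let ?R = "resolvent_rel l T"
  have R: "lin_rel ?R" "closed ?R"
    by (intro lin_rel_resolvent_rel closed_resolvent_rel T)+
  define d where "d = m - l"
  define v where "v = w - d *\<^sub>C x"
  have "(v, x) \<in> ?R"
    using resolvent_rel_shift[of v m l x T] wx by (simp add: v_def d_def)
  then obtain s where s: "(v, s) \<in> op_part ?R" and n: "x - s \<in> mul_part ?R"
    by (rule op_part_decomposition[OF R])
  have sn: "cinner s (x - s) = 0" using s n by (meson mem_op_part_iff orthogonal_complementD)
  have "cinner (l *\<^sub>C s - v) (x - s) = cinner s (l *\<^sub>C (x - s))"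
  proof (rule hermitianD[OF T(3)])
    show "(x - s, l *\<^sub>C (x - s)) \<in> T"
      using n unfolding mul_part_resolvent_rel eigenspace_def by blast
    show "(s, l *\<^sub>C s - v) \<in> T" using s by (simp add: mem_op_part_iff mem_resolvent_rel_iff)
  qed
  then have "cinner v (x - s) = 0"
    using sn
    by (simp only: cinner.diff_left[of "l *\<^sub>C s"] cinner_scaleC_left cinner_scaleC_right) simp
  then have orth: "cinner (v + d *\<^sub>C s) (d *\<^sub>C (x - s)) = 0"
    using sn by (simp only: cinner.add_left cinner_scaleC_left cinner_scaleC_right) simp
  have "w = (v + d *\<^sub>C s) + d *\<^sub>C (x - s)" by (simp add: v_def scaleC.diff_right)
  then have "norm (v + d *\<^sub>C s) \<le> norm w" "norm (d *\<^sub>C (x - s)) \<le> norm w"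
    using norm_le_norm_add_orthogonal[OF orth] by (simp_all only:)
  then show ?thesis using s that unfolding d_def norm_scaleC by blast
qed

lemma bounded_op_part_punctured_resolvent:
  assumes T: "lin_rel T" "selfadjoint T" and bdd: "bounded_rel (op_part (resolvent_rel l T))"
  obtains e where "e > 0" "\<And>m. m \<noteq> l \<Longrightarrow> dist m l < e \<Longrightarrow> m \<in> rel_resolvent_set T"
proof -
  obtain K where K: "K > 0" "\<And>w x. (w, x) \<in> op_part (resolvent_rel l T) \<Longrightarrow> norm x \<le> K * norm w"
    using bounded_relE[OF bdd] by metis
  have "m \<in> rel_resolvent_set T" if m: "m \<noteq> l" "dist m l < 1 / (2 * K)" for m
  proof (rule selfadjoint_resolvent_setI[OF T bounded_relI])
    define d where "d = m - l"
    have d: "d \<noteq> 0" "2 * K * cmod d \<le> 1"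
      using m K(1) by (auto simp: d_def dist_norm field_simps)
    fix w x assume wx: "(w, x) \<in> resolvent_rel m T"
    obtain v s where s: "(v, s) \<in> op_part (resolvent_rel l T)"
      and w: "norm (v + d *\<^sub>C s) \<le> norm w" "cmod d * norm (x - s) \<le> norm w"
      using resolvent_rel_eigenspace_decomposition[OF T(1) selfadjoint_imp_closed[OF T(2)]
          selfadjoint_imp_hermitian[OF T(2)] wx, of l] unfolding d_def by blast
    have "norm s \<le> K * norm v" using K(2) s by blast
    also have "\<dots> \<le> K * (norm (v + d *\<^sub>C s) + cmod d * norm s)"
      using norm_triangle_ineq4[of "v + d *\<^sub>C s" "d *\<^sub>C s"] K(1) by (simp add: norm_scaleC)
    also have "\<dots> \<le> K * norm w + K * cmod d * norm s"
      using w(1) K(1) by (simp add: distrib_left)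
    also have "\<dots> \<le> K * norm w + 1/2 * norm s"
      using mult_right_mono[OF d(2), of "norm s"] by simp
    finally have "norm s \<le> 2 * K * norm w" by simp
    moreover have "norm (x - s) \<le> inverse (cmod d) * norm w"
      using w(2) d(1) by (simp add: field_simps)
    moreover have "norm x \<le> norm s + norm (x - s)" using norm_triangle_ineq[of s "x - s"] by simp
    ultimately show "norm x \<le> (2 * K + inverse (cmod d)) * norm w" by (simp add: distrib_right)
  qed
  then show ?thesis using K(1) by (intro that[of "1 / (2 * K)"]) auto
qed

text \<open>For \<open>y = (a - b - T)\<^sup>-\<^sup>1 (a + b - T)\<^sup>-\<^sup>1 x\<close> the form \<open>\<langle>(a - T)z, (a - T)y\<rangle> - b\<^sup>2 \<langle>z, y\<rangle>\<close> 
  is \<open>\<langle>z, x\<rangle>\<close>.\<close>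

lemma resolvent_pair_form_representation:
  fixes a b :: real
  assumes T: "hermitian T"
    and res: "complex_of_real (a + b) \<in> rel_resolvent_set T"
      "complex_of_real (a - b) \<in> rel_resolvent_set T"
  obtains C where "C > 0" "\<And>x. \<exists>v y. (v, y) \<in> resolvent_rel a T \<and> norm y \<le> C * norm x \<and>
    (\<forall>(w, z)\<in>resolvent_rel a T. cinner w v - b\<^sup>2 * cinner z y = cinner z x)"
proof -
  obtain K L where K: "K > 0"
      "\<And>w x. (w, x) \<in> resolvent_rel (of_real (a + b)) T \<Longrightarrow> norm x \<le> K * norm w"
    and L: "L > 0"
      "\<And>w x. (w, x) \<in> resolvent_rel (of_real (a - b)) T \<Longrightarrow> norm x \<le> L * norm w"
    using res[THEN resolvent_set_bounded_rel] by (metis bounded_relE)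
  have "\<exists>v y. (v, y) \<in> resolvent_rel a T \<and> norm y \<le> (L * K) * norm x \<and>
    (\<forall>(w, z)\<in>resolvent_rel a T. cinner w v - b\<^sup>2 * cinner z y = cinner z x)" for x
  proof -
    obtain u y where u: "(x, u) \<in> resolvent_rel (of_real (a + b)) T"
      and y: "(u, y) \<in> resolvent_rel (of_real (a - b)) T"
      using res[THEN resolvent_set_rdom] unfolding rdom_def by blast
    have u': "(x - b *\<^sub>C u, u) \<in> resolvent_rel a T"
      using u resolvent_rel_shift[of x a "of_real (a + b)" u T] by (simp add: scaleC.minus_left)
    have y': "(u + b *\<^sub>C y, y) \<in> resolvent_rel a T"
      using y resolvent_rel_shift[of u a "of_real (a - b)" y T] by simp
    have "cinner w (u + b *\<^sub>C y) - b\<^sup>2 * cinner z y = cinner z x"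
      if wz: "(w, z) \<in> resolvent_rel a T" for w z
    proof -
      have "cinner w u = cinner z (x - b *\<^sub>C u)" "cinner w y = cinner z (u + b *\<^sub>C y)"
        using hermitian_cinner_resolvent_rel[OF T wz] u' y' by simp_all
      then show ?thesis by (simp add: cinner_simps power2_eq_square algebra_simps)
    qed
    moreover have "norm y \<le> (L * K) * norm x"
      using order_trans[OF L(2)[OF y] mult_left_mono[OF K(2)[OF u]]] L(1) by (simp add: mult.assoc)
    ultimately show ?thesis using y' by blast
  qed
  then show ?thesis using K(1) L(1) by (intro that[of "L * K"]) simp_all
qed

lemma resolvent_pair_form_coercive:
  fixes a b :: real
  assumes T: "lin_rel T" "hermitian T" and b: "b \<ge> 0"
    and res: "complex_of_real (a + b) \<in> rel_resolvent_set T"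
      "complex_of_real (a - b) \<in> rel_resolvent_set T"
    and bound: "\<And>w x. (w, x) \<in> resolvent_rel a T \<Longrightarrow> b * norm x \<le> norm w"
  obtains s where "s > 0"
    "\<And>w x. (w, x) \<in> resolvent_rel a T \<Longrightarrow> (b\<^sup>2 + s) * (norm x)\<^sup>2 \<le> (norm w)\<^sup>2"
proof -
  obtain C where C: "C > 0" "\<And>x. \<exists>v y. (v, y) \<in> resolvent_rel a T \<and> norm y \<le> C * norm x \<and>
    (\<forall>(w, z)\<in>resolvent_rel a T. cinner w v - b\<^sup>2 * cinner z y = cinner z x)"
    using resolvent_pair_form_representation[OF T(2) res] by blast
  define s where "s = 1 / C"
  have "(b\<^sup>2 + s) * (norm x)\<^sup>2 \<le> (norm w)\<^sup>2" if wx: "(w, x) \<in> resolvent_rel a T" for w x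
  proof -
    obtain v y where vy: "(v, y) \<in> resolvent_rel a T" "norm y \<le> C * norm x"
      and form: "\<And>w z. (w, z) \<in> resolvent_rel a T \<Longrightarrow> cinner w v - b\<^sup>2 * cinner z y = cinner z x"
      using C(2)[of x] by blast
    have form_x: "Re (cinner w v) - b\<^sup>2 * Re (cinner x y) = (norm x)\<^sup>2"
      using form[OF wx, THEN arg_cong[where f=Re]] by (simp add: norm_sq_eq_cinner)
    have form_y: "(norm v)\<^sup>2 - b\<^sup>2 * (norm y)\<^sup>2 = Re (cinner y x)"
      using form[OF vy(1), THEN arg_cong[where f=Re]] by (simp add: norm_sq_eq_cinner)
    have "(w - s *\<^sub>R v, x - s *\<^sub>R y) \<in> resolvent_rel a T"
      by (intro lin_rel_diff lin_rel_scaleR lin_rel_resolvent_rel T wx vy)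
    then have "(b * norm (x - s *\<^sub>R y))\<^sup>2 \<le> (norm (w - s *\<^sub>R v))\<^sup>2"
      using bound b by (intro power_mono) auto
    then have "0 \<le> (norm w)\<^sup>2 - b\<^sup>2 * (norm x)\<^sup>2 - 2 * s * (Re (cinner w v) - b\<^sup>2 * Re (cinner x y))
        + s\<^sup>2 * ((norm v)\<^sup>2 - b\<^sup>2 * (norm y)\<^sup>2)"
      by (simp add: power_mult_distrib norm_diff_sq cinner.scaleR_right algebra_simps)
    moreover have "s\<^sup>2 * Re (cinner y x) \<le> s * (norm x)\<^sup>2"
    proof -
      have "Re (cinner y x) \<le> norm y * norm x"
        using complex_Re_le_cmod Cauchy_Schwarz_cinner by (rule order_trans)
      also have "\<dots> \<le> C * norm x * norm x" using vy(2) by (intro mult_right_mono) auto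
      finally show ?thesis using C(1) by (simp add: s_def field_simps power2_eq_square)
    qed
    ultimately show ?thesis unfolding form_x form_y by (simp add: algebra_simps)
  qed
  then show ?thesis using C(1) by (intro that[of s]) (simp_all add: s_def)
qed

lemma resolvent_lower_bound_improves:
  fixes a b :: real
  assumes T: "lin_rel T" "hermitian T" and b: "b \<ge> 0"
    and res: "complex_of_real (a + b) \<in> rel_resolvent_set T"
      "complex_of_real (a - b) \<in> rel_resolvent_set T"
    and bound: "\<And>w x. (w, x) \<in> resolvent_rel a T \<Longrightarrow> b * norm x \<le> norm w"
  obtains b' where "b' > b" "\<And>w x. (w, x) \<in> resolvent_rel a T \<Longrightarrow> b' * norm x \<le> norm w"
proof -
  obtain s where s: "s > 0"
    "\<And>w x. (w, x) \<in> resolvent_rel a T \<Longrightarrow> (b\<^sup>2 + s) * (norm x)\<^sup>2 \<le> (norm w)\<^sup>2"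
    using resolvent_pair_form_coercive[OF T b res bound] by blast
  have "sqrt (b\<^sup>2 + s) * norm x \<le> norm w" if "(w, x) \<in> resolvent_rel a T" for w x
  proof (rule power2_le_imp_le)
    show "(sqrt (b\<^sup>2 + s) * norm x)\<^sup>2 \<le> (norm w)\<^sup>2"
      using s(1) s(2)[OF that] by (simp add: power_mult_distrib)
  qed simp
  moreover have "sqrt (b\<^sup>2 + s) > b" using s(1) by (intro real_less_rsqrt) simp
  ultimately show ?thesis using that by blast
qed

lemma resolvent_norm_le_inverse_distance:
  fixes a r :: real
  assumes T: "lin_rel T" "hermitian T"
    and res: "\<And>t. \<bar>t\<bar> < r \<Longrightarrow> complex_of_real (a + t) \<in> rel_resolvent_set T"
    and wx: "(w, x) \<in> resolvent_rel a T"
  shows "r * norm x \<le> norm w"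
proof (rule ccontr)
  assume less: "\<not> r * norm x \<le> norm w"
  define P where "P = {p \<in> resolvent_rel a T. snd p \<noteq> 0}"
  define b where "b = (INF p\<in>P. norm (fst p) / norm (snd p))"
  have bdd: "bdd_below ((\<lambda>p. norm (fst p) / norm (snd p)) ` P)" by (intro bdd_belowI2[of _ 0]) simp
  have "x \<noteq> 0" using less by auto
  then have P: "(w, x) \<in> P" using wx by (simp add: P_def)
  have b: "b \<ge> 0" unfolding b_def using P by (intro cINF_greatest) auto
  have "b \<le> norm w / norm x" unfolding b_def using cINF_lower[OF bdd P] by simp
  also have "\<dots> < r" using less \<open>x \<noteq> 0\<close> by (simp add: divide_less_eq)
  finally have "b < r" .
  then have near: "complex_of_real (a + b) \<in> rel_resolvent_set T"
    "complex_of_real (a - b) \<in> rel_resolvent_set T"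
    using res[of b] res[of "- b"] b by simp_all
  have bound: "b * norm z \<le> norm v" if "(v, z) \<in> resolvent_rel a T" for v z
  proof (cases "z = 0")
    case False
    then have "b \<le> norm v / norm z"
      using cINF_lower[OF bdd, of "(v, z)"] that by (simp add: P_def b_def)
    then show ?thesis using False by (simp add: le_divide_eq)
  qed simp
  obtain b' where b': "b' > b" "\<And>v z. (v, z) \<in> resolvent_rel a T \<Longrightarrow> b' * norm z \<le> norm v"
    using resolvent_lower_bound_improves[OF T b near bound] by blast
  have "b' \<le> b" unfolding b_def
    using P b'(2) by (intro cINF_greatest) (auto simp: P_def le_divide_eq)
  then show False using b'(1) by simp
qed

context
  fixes T :: "('a::chilbert \<times> 'a) set" and a e :: real
  assumes T: "lin_rel T" "hermitian T" and e: "e > 0"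
    and res: "\<And>t. t \<noteq> 0 \<Longrightarrow> \<bar>t\<bar> < e \<Longrightarrow> complex_of_real (a + t) \<in> rel_resolvent_set T"
begin

lemma isolated_point_form_bound:
  assumes wx: "(w, x) \<in> resolvent_rel a T"
  shows "e * \<bar>Re (cinner w x)\<bar> \<le> (norm w)\<^sup>2"
proof -
  have "- (2 * s * Re (cinner w x)) \<le> (norm w)\<^sup>2" if s: "\<bar>s\<bar> = e / 2" for s
  proof -
    have "\<bar>s\<bar> * norm x \<le> norm (w + s *\<^sub>R x)"
    proof (rule resolvent_norm_le_inverse_distance[OF T])
      fix t assume "\<bar>t\<bar> < \<bar>s\<bar>"
      then have "s + t \<noteq> 0" "\<bar>s + t\<bar> < e" using s by linarith+
      then show "complex_of_real (a + s + t) \<in> rel_resolvent_set T"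
        using res[of "s + t"] by (simp add: add.assoc)
    next
      show "(w + s *\<^sub>R x, x) \<in> resolvent_rel (of_real (a + s)) T"
        using wx resolvent_rel_shift[of w "of_real (a + s)" a x T] by (simp add: scaleR_scaleC)
    qed
    then have "(\<bar>s\<bar> * norm x)\<^sup>2 \<le> (norm (w + s *\<^sub>R x))\<^sup>2" by (rule power_mono) simp
    then show ?thesis
      unfolding norm_add_sq by (simp add: cinner.scaleR_right power_mult_distrib)
  qed
  from this[of "e / 2"] this[of "- e / 2"] show ?thesis
    using e by (cases "Re (cinner w x) \<ge> 0") auto
qed

lemma isolated_point_polarized_bound:
  assumes wx: "(w, x) \<in> resolvent_rel a T" and vy: "(v, y) \<in> resolvent_rel a T"
  shows "2 * e * Re (cinner v x) \<le> (norm w)\<^sup>2 + (norm v)\<^sup>2"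
proof -
  have lin: "lin_rel (resolvent_rel a T)" by (rule lin_rel_resolvent_rel[OF T(1)])
  have "cinner w y = cinner x v" using hermitian_cinner_resolvent_rel[OF T(2) wx] vy by simp
  then have "Re (cinner (w + v) (x + y)) - Re (cinner (w - v) (x - y)) = 4 * Re (cinner v x)"
    using Re_cinner_commute[of x v] by (simp add: cinner_simps)
  then have "4 * Re (cinner v x)
      \<le> \<bar>Re (cinner (w + v) (x + y))\<bar> + \<bar>Re (cinner (w - v) (x - y))\<bar>" by linarith
  then have "e * (4 * Re (cinner v x))
      \<le> e * (\<bar>Re (cinner (w + v) (x + y))\<bar> + \<bar>Re (cinner (w - v) (x - y))\<bar>)"
    using e by (intro mult_left_mono) auto
  also have "\<dots> \<le> (norm (w + v))\<^sup>2 + (norm (w - v))\<^sup>2"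
    using isolated_point_form_bound[OF lin_rel_add[OF lin wx vy]]
      isolated_point_form_bound[OF lin_rel_diff[OF lin wx vy]] by (simp add: distrib_left)
  also have "\<dots> = 2 * (norm w)\<^sup>2 + 2 * (norm v)\<^sup>2" by (simp add: norm_add_sq norm_diff_sq)
  finally show ?thesis by simp
qed

lemma isolated_point_lower_bound_on_closure:
  assumes wx: "(w, x) \<in> resolvent_rel a T" and x: "x \<in> closure (rdom (resolvent_rel a T))"
  shows "e * norm x \<le> norm w"
proof -
  obtain v where v: "\<And>n. v n \<in> rdom (resolvent_rel a T)" "v \<longlonglongrightarrow> x"
    using x unfolding closure_sequential by blast
  have "2 * e * Re (cinner (e *\<^sub>R v n) x) \<le> (norm w)\<^sup>2 + (norm (e *\<^sub>R v n))\<^sup>2" for n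
  proof -
    obtain y where "(v n, y) \<in> resolvent_rel a T" using v(1) by (auto simp: rdom_def)
    then have "(e *\<^sub>R v n, e *\<^sub>R y) \<in> resolvent_rel a T"
      by (intro lin_rel_scaleR lin_rel_resolvent_rel T)
    then show ?thesis by (rule isolated_point_polarized_bound[OF wx])
  qed
  then have "2 * e * Re (cinner (e *\<^sub>R x) x) \<le> (norm w)\<^sup>2 + (norm (e *\<^sub>R x))\<^sup>2"
    by (intro LIMSEQ_le[of "\<lambda>n. 2 * e * Re (cinner (e *\<^sub>R v n) x)" _
          "\<lambda>n. (norm w)\<^sup>2 + (norm (e *\<^sub>R v n))\<^sup>2"] tendsto_intros cinner.tendsto v(2)) blast
  then have "(e * norm x)\<^sup>2 \<le> (norm w)\<^sup>2"
    by (simp add: cinner.scaleR_left norm_sq_eq_cinner[symmetric] power_mult_distrib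
        power2_eq_square[of e])
  then show ?thesis by (rule power2_le_imp_le) simp
qed

end

lemma isolated_point_bounded_op_part:
  fixes a e :: real
  assumes T: "lin_rel T" "selfadjoint T" and e: "e > 0"
    and res: "\<And>t. t \<noteq> 0 \<Longrightarrow> \<bar>t\<bar> < e \<Longrightarrow> complex_of_real (a + t) \<in> rel_resolvent_set T"
  shows "bounded_rel (op_part (resolvent_rel a T))"
proof (rule bounded_relI)
  let ?R = "resolvent_rel a T"
  fix w x assume "(w, x) \<in> op_part ?R"
  then have wx: "(w, x) \<in> ?R" and "x \<in> orthogonal_complement (orthogonal_complement (rdom ?R))"
    by (simp_all add: mem_op_part_iff mul_part_resolvent_rel
        orthogonal_complement_rdom_resolvent_rel[OF T(2)])
  then have "x \<in> closure (rdom ?R)"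
    using double_orthogonal_complement_subset_closure
      subspace_rdom[OF lin_rel_resolvent_rel[OF T(1)]] by blast
  then have "e * norm x \<le> norm w"
    by (intro isolated_point_lower_bound_on_closure[OF T(1) _ e res wx]
        selfadjoint_imp_hermitian T)
  then show "norm x \<le> inverse e * norm w" using e by (simp add: field_simps)
qed

lemma semi_fredholm_not_ess_spectrum:
  assumes T: "lin_rel T" "selfadjoint T" and l: "semi_fredholm T l"
  shows "l \<notin> ess_spectrum T"
proof -
  obtain e where "e > 0" "\<And>m. m \<noteq> l \<Longrightarrow> dist m l < e \<Longrightarrow> m \<in> rel_resolvent_set T"
    using bounded_op_part_punctured_resolvent[OF T] l unfolding semi_fredholm_def by blast
  then have "\<not> l islimpt rel_spectrum T"
    unfolding islimpt_approachable rel_spectrum_def by blast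
  then show ?thesis using l by (simp add: ess_spectrum_def semi_fredholm_def)
qed

lemma infinite_dim_eigenspace_is_eigenvalue:
  "infinite_dim (eigenspace T l) \<Longrightarrow> is_eigenvalue T l"
  using infinite_dim_imp_nonzero unfolding is_eigenvalue_def eigenspace_def by blast

lemma resolvent_set_semi_fredholm:
  assumes "l \<in> rel_resolvent_set T"
  shows "semi_fredholm T l"
proof -
  have bdd: "bounded_rel (resolvent_rel l T)" by (rule resolvent_set_bounded_rel[OF assms])
  then have "eigenspace T l \<subseteq> {0}" using bounded_rel_mul_part mul_part_resolvent_rel by metis
  then have "\<not> infinite_dim (eigenspace T l)" using infinite_dim_imp_nonzero by blast
  moreover have "bounded_rel (op_part (resolvent_rel l T))"
    using bdd unfolding bounded_rel_def op_part_def by blast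
  ultimately show ?thesis by (simp add: semi_fredholm_def)
qed

lemma not_ess_spectrum_semi_fredholm:
  assumes T: "lin_rel T" "selfadjoint T" and l: "l \<notin> ess_spectrum T"
  shows "semi_fredholm T l"
proof (cases "l \<in> rel_resolvent_set T")
  case True
  then show ?thesis by (rule resolvent_set_semi_fredholm)
next
  case False
  then have isolated: "\<not> l islimpt rel_spectrum T" and fin: "\<not> infinite_dim (eigenspace T l)"
    using l infinite_dim_eigenspace_is_eigenvalue by (auto simp: ess_spectrum_def rel_spectrum_def)
  have "Im l = 0" using False selfadjoint_nonreal_resolvent[OF T] by blast
  then have l_real: "l = complex_of_real (Re l)" by (simp add: complex_eq_iff)
  obtain e where e: "e > 0" "\<And>z. z \<in> rel_spectrum T \<Longrightarrow> z \<noteq> l \<Longrightarrow> e \<le> dist z l"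
    using isolated unfolding islimpt_approachable by (meson not_le)
  have "complex_of_real (Re l + t) \<in> rel_resolvent_set T" if "t \<noteq> 0" "\<bar>t\<bar> < e" for t
  proof -
    have "complex_of_real (Re l + t) = l + t" using l_real by simp
    then show ?thesis using e(2)[of "l + t"] that by (force simp: rel_spectrum_def dist_norm)
  qed
  then have "bounded_rel (op_part (resolvent_rel l T))"
    using isolated_point_bounded_op_part[OF T e(1), of "Re l"] l_real by metis
  then show ?thesis using fin by (simp add: semi_fredholm_def)
qed

lemma ess_spectrum_iff_not_semi_fredholm:
  assumes "lin_rel T" "selfadjoint T"
  shows "l \<in> ess_spectrum T \<longleftrightarrow> \<not> semi_fredholm T l"
  using semi_fredholm_not_ess_spectrum[OF assms] not_ess_spectrum_semi_fredholm[OF assms] by blast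

section \<open>Perturbation by a relatively compact Hermitian relation\<close>

lemma lin_rel_relation_sum:
  assumes "lin_rel S" "lin_rel A"
  shows "lin_rel (relation_sum S A)"
  unfolding lin_rel_def
proof (intro conjI allI impI)
  show "(0, 0) \<in> relation_sum S A"
    using assms[THEN lin_rel_zero] by (force simp: relation_sum_def)
next
  fix x f y g assume "(x, f) \<in> relation_sum S A" "(y, g) \<in> relation_sum S A"
  then obtain f1 f2 g1 g2 where "(x, f1) \<in> S" "(x, f2) \<in> A" "f = f1 + f2"
    "(y, g1) \<in> S" "(y, g2) \<in> A" "g = g1 + g2" by (auto simp: relation_sum_def)
  then have "(x + y, f1 + g1) \<in> S" "(x + y, f2 + g2) \<in> A" "f + g = (f1 + g1) + (f2 + g2)"
    by (simp_all add: lin_rel_add assms)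
  then show "(x + y, f + g) \<in> relation_sum S A" unfolding relation_sum_def by blast
next
  fix c x f assume "(x, f) \<in> relation_sum S A"
  then obtain f1 f2 where "(x, f1) \<in> S" "(x, f2) \<in> A" "f = f1 + f2"
    by (auto simp: relation_sum_def)
  then have "(c *\<^sub>C x, c *\<^sub>C f1) \<in> S" "(c *\<^sub>C x, c *\<^sub>C f2) \<in> A"
    "c *\<^sub>C f = c *\<^sub>C f1 + c *\<^sub>C f2"
    by (simp_all add: lin_rel_scaleC assms scaleC_add_right)
  then show "(c *\<^sub>C x, c *\<^sub>C f) \<in> relation_sum S A" unfolding relation_sum_def by blast
qed

lemma hermitian_relation_sum:
  assumes "hermitian S" "hermitian A"
  shows "hermitian (relation_sum S A)"
  unfolding hermitian_def radjoint_def relation_sum_def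
  using hermitianD[OF assms(1)] hermitianD[OF assms(2)] by (auto simp: cinner_simps)

locale hermitian_perturbation =
  fixes S A :: "('a::chilbert \<times> 'a) set"
  assumes S: "lin_rel S" "selfadjoint S"
    and A: "lin_rel A" "closed A" "hermitian A"
    and dom: "rdom S \<subseteq> rdom A"
begin

lemmas closed_S = selfadjoint_imp_closed[OF S(2)]

text \<open>\<open>A(0)\<close> is orthogonal to \<open>D(A) \<supseteq> D(S)\<close>, and the orthogonal complement of \<open>D(S)\<close> is \<open>S(0)\<close>.\<close>

lemma mul_part_A_subset_mul_part_S: "mul_part A \<subseteq> mul_part S"
proof
  fix g assume g: "g \<in> mul_part A"
  have "(0, g) \<in> S"
  proof (rule selfadjoint_memI[OF S(2)])
    fix x f assume "(x, f) \<in> S"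
    then obtain h where "(x, h) \<in> A" using dom by (auto simp: rdom_def)
    then show "cinner g x = cinner 0 f"
      using hermitianD[OF A(3), of x h 0 g] g by (simp add: mul_part_def)
  qed
  then show "g \<in> mul_part S" by (simp add: mul_part_def)
qed

lemma op_fun_A_mem: "x \<in> rdom S \<Longrightarrow> (x, op_fun A x) \<in> A"
  using op_fun_mem[OF A(1,2)] dom by blast

lemma mem_relation_sum_iff: "(x, h) \<in> relation_sum S A \<longleftrightarrow> (x, h - op_fun A x) \<in> S"
proof
  assume "(x, h) \<in> relation_sum S A"
  then obtain f g where f: "(x, f) \<in> S" and g: "(x, g) \<in> A" and h: "h = f + g"
    by (auto simp: relation_sum_def)
  have "(x, op_fun A x) \<in> A" using f by (intro op_fun_A_mem) (auto simp: rdom_def)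
  then have "(0, g - op_fun A x) \<in> S"
    using lin_rel_diff[OF A(1) g, of x "op_fun A x"] mul_part_A_subset_mul_part_S
    by (auto simp: mul_part_def)
  then show "(x, h - op_fun A x) \<in> S"
    using lin_rel_add[OF S(1) f, of 0 "g - op_fun A x"] by (simp add: h algebra_simps)
next
  assume f: "(x, h - op_fun A x) \<in> S"
  then have "(x, op_fun A x) \<in> A" by (intro op_fun_A_mem) (auto simp: rdom_def)
  with f have "(x, (h - op_fun A x) + op_fun A x) \<in> relation_sum S A"
    unfolding relation_sum_def by blast
  then show "(x, h) \<in> relation_sum S A" by simp
qed

lemma mem_resolvent_relation_sum_iff:
  "(w, x) \<in> resolvent_rel l (relation_sum S A) \<longleftrightarrow> (w + op_fun A x, x) \<in> resolvent_rel l S"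
  by (simp add: mem_resolvent_rel_iff mem_relation_sum_iff algebra_simps)

lemma op_fun_A_resolvent_bound:
  assumes bound: "relatively_bounded A S e K" and K: "K \<ge> 0"
    and e: "e \<ge> 0" and l: "Re l = 0" "Im l \<noteq> 0" and wx: "(w, x) \<in> resolvent_rel l S"
  shows "norm (op_fun A x) \<le> (e + K / \<bar>Im l\<bar>) * norm w"
proof -
  define f where "f = l *\<^sub>C x - w"
  have f: "(x, f) \<in> S" using wx by (simp add: f_def mem_resolvent_rel_iff)
  have "(norm w)\<^sup>2 = (Im l * norm x)\<^sup>2 + (norm f)\<^sup>2"
    using hermitian_norm_shift_sq[OF selfadjoint_imp_hermitian[OF S(2)] f, of l] l(1)
    by (simp add: f_def norm_minus_commute)
  then have "(\<bar>Im l\<bar> * norm x)\<^sup>2 \<le> (norm w)\<^sup>2" "(norm f)\<^sup>2 \<le> (norm w)\<^sup>2"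
    by (simp_all add: power_mult_distrib)
  then have w: "\<bar>Im l\<bar> * norm x \<le> norm w" "norm f \<le> norm w" by (auto dest: power2_le_imp_le)
  have "norm (op_fun S x) \<le> norm w" using norm_op_fun_le[OF S(1) closed_S f] w(2) by simp
  then have "e * norm (op_fun S x) \<le> e * norm w" using e by (rule mult_left_mono)
  moreover have "K * norm x \<le> K / \<bar>Im l\<bar> * norm w"
    using mult_left_mono[OF w(1) K] l(2) by (simp add: field_simps)
  moreover have "x \<in> rdom S" using f by (auto simp: rdom_def)
  then have "norm (op_fun A x) \<le> e * norm (op_fun S x) + K * norm x"
    using bound unfolding relatively_bounded_def by blast
  ultimately show ?thesis by (simp add: distrib_right)
qed

lemma rdom_resolvent_relation_sum:
  assumes bound: "relatively_bounded A S e K" and K: "K \<ge> 0"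
    and e: "e \<ge> 0" and l: "Re l = 0" "Im l \<noteq> 0" and contraction: "e + K / \<bar>Im l\<bar> < 1"
  shows "rdom (resolvent_rel l (relation_sum S A)) = UNIV"
proof -
  have "rdom (resolvent_rel l S) = UNIV"
    by (intro resolvent_set_rdom selfadjoint_nonreal_resolvent S l)
  then have "\<forall>w. \<exists>x. (w, x) \<in> resolvent_rel l S" unfolding rdom_def by blast
  then obtain B where B: "\<And>w. (w, B w) \<in> resolvent_rel l S" by metis
  have BA: "B w \<in> rdom A" for w
    using B[of w] dom by (auto simp: rdom_def mem_resolvent_rel_iff)
  have "z \<in> rdom (resolvent_rel l (relation_sum S A))" for z
  proof -
    have "dist (z + op_fun A (B v)) (z + op_fun A (B w)) \<le> (e + K / \<bar>Im l\<bar>) * dist v w" for v w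
    proof -
      have "(v - w, B v - B w) \<in> resolvent_rel l S"
        by (intro lin_rel_diff lin_rel_resolvent_rel S B)
      from op_fun_A_resolvent_bound[OF bound K e l this] show ?thesis
        by (simp add: dist_norm op_fun_diff[OF A(1,2) BA BA])
    qed
    then have "\<exists>!w. z + op_fun A (B w) = w"
      using K e contraction by (intro banach_fix_type[of "e + K / \<bar>Im l\<bar>"]) auto
    then obtain w where "z + op_fun A (B w) = w" by blast
    then have "(z, B w) \<in> resolvent_rel l (relation_sum S A)"
      using B[of w] by (simp add: mem_resolvent_relation_sum_iff)
    then show ?thesis by (auto simp: rdom_def)
  qed
  then show ?thesis by blast
qed

theorem kato_rellich:
  assumes bound: "relatively_bounded A S e K" and K: "K \<ge> 0"
    and e: "0 \<le> e" "e < 1"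
  shows "selfadjoint (relation_sum S A)"
proof (rule hermitian_surj_imp_selfadjoint)
  define c where "c = (K + 1) / (1 - e)"
  have c: "c > 0" using K e by (simp add: c_def)
  have "K / c < 1 - e" using K e by (simp add: c_def field_simps)
  then have contraction: "e + K / \<bar>Im l\<bar> < 1" if "\<bar>Im l\<bar> = c" for l using that by simp
  show "rdom (resolvent_rel (Complex 0 c) (relation_sum S A)) = UNIV"
    using c by (intro rdom_resolvent_relation_sum[OF bound K e(1)] contraction) auto
  show "rdom (resolvent_rel (cnj (Complex 0 c)) (relation_sum S A)) = UNIV"
    using c by (intro rdom_resolvent_relation_sum[OF bound K e(1)] contraction) auto
qed (intro lin_rel_relation_sum hermitian_relation_sum selfadjoint_imp_hermitian S A)+

end

locale compact_perturbation = hermitian_perturbation +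
  assumes compact: "rel_compact (op_part A) (op_part S)"
begin

lemma relatively_bounded_half:
  obtains K where "K \<ge> 0" "relatively_bounded A S (1/2) K"
  using rel_compact_imp_relatively_bounded[OF S(1) closed_S A(1,2) dom compact, of "1/2"] by auto

lemma selfadjoint_relation_sum: "selfadjoint (relation_sum S A)"
proof -
  obtain K where "K \<ge> 0" "relatively_bounded A S (1/2) K" by (rule relatively_bounded_half)
  then show ?thesis using kato_rellich[of "1/2" K] by simp
qed

lemma norm_op_fun_S_le:
  assumes "(w, x) \<in> resolvent_rel l S"
  shows "norm (op_fun S x) \<le> cmod l * norm x + norm w"
proof -
  have "norm (op_fun S x) \<le> norm (l *\<^sub>C x - w)"
    using assms by (intro norm_op_fun_le S closed_S) (simp add: mem_resolvent_rel_iff)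
  also have "\<dots> \<le> cmod l * norm x + norm w"
    using norm_triangle_ineq4[of "l *\<^sub>C x" w] by (simp add: norm_scaleC)
  finally show ?thesis .
qed

lemma norm_op_fun_S_le_relation_sum:
  obtains M where "M \<ge> 0" "\<And>w x. (w, x) \<in> resolvent_rel l (relation_sum S A) \<Longrightarrow>
    norm (op_fun S x) \<le> M * norm x + 2 * norm w"
proof -
  obtain K where K: "K \<ge> 0" "relatively_bounded A S (1/2) K" by (rule relatively_bounded_half)
  have "norm (op_fun S x) \<le> 2 * (cmod l + K) * norm x + 2 * norm w"
    if "(w, x) \<in> resolvent_rel l (relation_sum S A)" for w x
  proof -
    have wx: "(w + op_fun A x, x) \<in> resolvent_rel l S"
      using that by (simp add: mem_resolvent_relation_sum_iff)
    have x: "x \<in> rdom S" using wx by (auto simp: rdom_def mem_resolvent_rel_iff)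
    have "norm (op_fun S x) \<le> cmod l * norm x + norm w + norm (op_fun A x)"
      using norm_op_fun_S_le[OF wx] norm_triangle_ineq[of w "op_fun A x"] by linarith
    moreover have "norm (op_fun A x) \<le> 1/2 * norm (op_fun S x) + K * norm x"
      using K(2) x unfolding relatively_bounded_def by blast
    ultimately show ?thesis by (simp add: algebra_simps)
  qed
  then show ?thesis using K(1) by (intro that[of "2 * (cmod l + K)"]) simp_all
qed

lemma op_fun_A_convergent_subsequence:
  assumes x: "\<And>n. x n \<in> rdom S" "bounded (range x)" and w: "convergent w" and M: "M \<ge> 0"
    and bound: "\<And>n. norm (op_fun S (x n)) \<le> M * norm (x n) + 2 * norm (w n)"
  obtains r g where "strict_mono (r::nat \<Rightarrow> nat)" "convergent (w \<circ> r)" "(\<lambda>n. op_fun A (x (r n))) \<longlonglongrightarrow> g"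
proof -
  obtain B C where B: "\<And>n. norm (x n) \<le> B" and C: "\<And>n. norm (w n) \<le> C"
    using x(2) convergent_imp_Bseq[OF w] by (auto simp: bounded_iff Bseq_def)
  have "norm (op_fun S (x n)) \<le> M * B + 2 * C" for n
    using bound[of n] mult_left_mono[OF B[of n] M] C[of n] by linarith
  then have "bounded (range (\<lambda>n. op_fun S (x n)))" by (auto simp: bounded_iff)
  then obtain r g where r: "strict_mono (r::nat \<Rightarrow> nat)" "(\<lambda>n. op_fun A (x (r n))) \<longlonglongrightarrow> g"
    using rel_compact_convergent_subsequence[OF S(1) closed_S A(1,2) dom compact x] by blast
  then show ?thesis using that convergent_subseq_convergent[OF w] by blast
qed

lemma proper_inverse_relation_sum:
  assumes proper: "proper_inverse (resolvent_rel l S)"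
  shows "proper_inverse (resolvent_rel l (relation_sum S A))"
proof (rule proper_inverse_subsequenceI[OF proper])
  fix w x
  assume wx: "\<And>n. (w n, x n) \<in> resolvent_rel l (relation_sum S A)"
    and w: "convergent w" and x: "bounded (range x)"
  have wx': "(w n + op_fun A (x n), x n) \<in> resolvent_rel l S" for n
    using wx by (simp add: mem_resolvent_relation_sum_iff)
  then have "x n \<in> rdom S" for n by (auto simp: rdom_def mem_resolvent_rel_iff)
  moreover obtain M where "M \<ge> 0" "\<And>n. norm (op_fun S (x n)) \<le> M * norm (x n) + 2 * norm (w n)"
    using norm_op_fun_S_le_relation_sum wx by metis
  ultimately obtain r g where r: "strict_mono (r::nat \<Rightarrow> nat)" "convergent (w \<circ> r)"
    and g: "(\<lambda>n. op_fun A (x (r n))) \<longlonglongrightarrow> g"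
    using op_fun_A_convergent_subsequence[OF _ x w] by metis
  have "convergent (\<lambda>n. w (r n) + op_fun A (x (r n)))"
    using convergent_add[OF r(2) convergentI[OF g]] by (simp add: o_def)
  then show "\<exists>r v. strict_mono (r::nat \<Rightarrow> nat) \<and> convergent v
      \<and> (\<forall>n. (v n, x (r n)) \<in> resolvent_rel l S)"
    using r(1) wx' by blast
qed

lemma proper_inverse_if_relation_sum:
  assumes proper: "proper_inverse (resolvent_rel l (relation_sum S A))"
  shows "proper_inverse (resolvent_rel l S)"
proof (rule proper_inverse_subsequenceI[OF proper])
  fix w x
  assume wx: "\<And>n. (w n, x n) \<in> resolvent_rel l S" and w: "convergent w" and x: "bounded (range x)"
  have wx': "(w n - op_fun A (x n), x n) \<in> resolvent_rel l (relation_sum S A)" for n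
    using wx by (simp add: mem_resolvent_relation_sum_iff)
  have "x n \<in> rdom S" for n using wx[of n] by (auto simp: rdom_def mem_resolvent_rel_iff)
  moreover have "norm (op_fun S (x n)) \<le> cmod l * norm (x n) + 2 * norm (w n)" for n
    using norm_op_fun_S_le[OF wx[of n]] norm_ge_zero[of "w n"] by linarith
  ultimately obtain r g where r: "strict_mono (r::nat \<Rightarrow> nat)" "convergent (w \<circ> r)"
    and g: "(\<lambda>n. op_fun A (x (r n))) \<longlonglongrightarrow> g"
    using op_fun_A_convergent_subsequence[OF _ x w norm_ge_zero] by metis
  have "convergent (\<lambda>n. w (r n) - op_fun A (x (r n)))"
    using convergent_diff[OF r(2) convergentI[OF g]] by (simp add: o_def)
  then show "\<exists>r v. strict_mono (r::nat \<Rightarrow> nat) \<and> convergent v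
      \<and> (\<forall>n. (v n, x (r n)) \<in> resolvent_rel l (relation_sum S A))"
    using r(1) wx' by blast
qed

lemma semi_fredholm_relation_sum_iff: "semi_fredholm (relation_sum S A) l \<longleftrightarrow> semi_fredholm S l"
  using proper_inverse_relation_sum proper_inverse_if_relation_sum
    semi_fredholm_iff_proper_inverse[OF S(1) closed_S]
    semi_fredholm_iff_proper_inverse[OF lin_rel_relation_sum[OF S(1) A(1)]
      selfadjoint_imp_closed[OF selfadjoint_relation_sum]]
  by blast

end

theorem theorem5p2:
  fixes S A :: "('a::chilbert \<times> 'a) set"
  assumes "lin_rel S" and "selfadjoint S"
    and "lin_rel A" and "closed A" and "hermitian A"
    and "rdom S \<subseteq> rdom A"
    and "rel_compact (op_part A) (op_part S)"
  shows "ess_spectrum S = ess_spectrum (relation_sum S A)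
         \<and> (ess_spectrum S = {} \<longleftrightarrow> ess_spectrum (relation_sum S A) = {})"
proof -
  interpret compact_perturbation S A by unfold_locales (rule assms)+
  have "ess_spectrum S = ess_spectrum (relation_sum S A)"
    using ess_spectrum_iff_not_semi_fredholm[OF S]
      ess_spectrum_iff_not_semi_fredholm[OF lin_rel_relation_sum[OF S(1) A(1)]
        selfadjoint_relation_sum]
      semi_fredholm_relation_sum_iff by blast
  then show ?thesis by simp
qed

end
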